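(* Let $\mathsf{N}\in\mathsf{NFI}_{\mathrm{PB}_4}(\mathrm{B}_4)$, let $[\psi]\in\mathsf{Dessin}(\mathsf{N})$ be a child's drawing and let $[m,f]\in\mathsf{GT}(\mathsf{N})$. Then the child's drawing $[\psi]^{[m,f]}$ has the same degree and the same monodromy group as $[\psi]$.
   Context: Braid groups. $\mathrm{B}_n$ is the Artin braid group on $n$ strands with standard generators $\sigma_1,\dots,\sigma_{n-1}$; $\mathrm{PB}_n\le \mathrm{B}_n$ is the pure braid group with generators $x_{ij} := \sigma_{j-1}\cdots\sigma_{i+1}\sigma_i^2\sigma_{i+1}^{-1}\cdots\sigma_{j-1}^{-1}$, $1\le i<j\le n$. Set $c := x_{23}x_{12}x_{13}\in \mathrm{PB}_3$; it generates the center of $\mathrm{PB}_3$. The elements $x:=x_{12}$, $y:=x_{23}$ generate a free subgroup of rank 2 in $\mathrm{PB}_3$, which is identified with the free group $\mathsf{F}_2$, and $\mathrm{PB}_3=\mathsf{F}_2\times\langle c\rangle$. $\mathsf{NFI}_{\mathrm{PB}_4}(\mathrm{B}_4)$ is the poset of finite index normal subgroups $\mathsf{N}\unlhd \mathrm{B}_4$ with $\mathsf{N}\le\mathrm{PB}_4$. Homomorphisms $\mathrm{PB}_3\to\mathrm{PB}_4$ (values on $x_{12},x_{23},x_{13}$): $\varphi_{123}: x_{12}, x_{23}, x_{13}$; $\varphi_{234}: x_{23}, x_{34}, x_{24}$; $\varphi_{12,3,4}: x_{13}x_{23},\ x_{34},\ x_{14}x_{24}$; $\varphi_{1,23,4}: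 x_{12}x_{13},\ x_{24}x_{34},\ x_{14}$; $\varphi_{1,2,34}: x_{12},\ x_{23}x_{24},\ x_{13}x_{14}$. For $\mathsf{N}\in\mathsf{NFI}_{\mathrm{PB}_4}(\mathrm{B}_4)$ let $\mathsf{N}_{\mathrm{PB}_3}$ be the intersection of the preimages of $\mathsf{N}$ under these five homomorphisms, let $N_{\mathrm{ord}}$ be the least common multiple of the orders of $x_{12}\mathsf{N}_{\mathrm{PB}_3}, x_{23}\mathsf{N}_{\mathrm{PB}_3}, c\,\mathsf{N}_{\mathrm{PB}_3}$ in $\mathrm{PB}_3/\mathsf{N}_{\mathrm{PB}_3}$, and $\mathsf{N}_{\mathsf{F}_2}:=\mathsf{N}_{\mathrm{PB}_3}\cap\mathsf{F}_2$. $\mathsf{GT}$-shadows. $\mathsf{GT}(\mathsf{N})$, the set of $\mathsf{GT}$-shadows with target $\mathsf{N}$, is the set of pairs $[m,f]:=(m+N_{\mathrm{ord}}\mathbb{Z},\ f\,\mathsf{N}_{\mathrm{PB}_3})$ represented by some $(m,f)\in\mathbb{Z}\times\mathsf{F}_2$ such that: (i) $\sigma_1 x_{12}^m f^{-1}\sigma_2 x_{23}^m f\,\mathsf{N}_{\mathrm{PB}_3} = f^{-1}\sigma_1\sigma_2 x_{12}^{-m}c^m\,\mathsf{N}_{\mathrm{PB}_3}$ and $f^{-1}\sigma_2x_{23}^m f\sigma_1x_{12}^m\,\mathsf{N}_{\mathrm{PB}_3} = \sigma_2\sigma_1x_{23}^{-m}c^m f\,\mathsf{N}_{\mathrm{PB}_3}$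 in $\mathrm{B}_3/\mathsf{N}_{\mathrm{PB}_3}$; (ii) $\varphi_{234}(f)\varphi_{1,23,4}(f)\varphi_{123}(f)\,\mathsf{N}=\varphi_{1,2,34}(f)\varphi_{12,3,4}(f)\,\mathsf{N}$ in $\mathrm{PB}_4/\mathsf{N}$; (iii) $2m+1$ is a unit modulo $N_{\mathrm{ord}}$; (iv) the homomorphism $\mathrm{PB}_3\to\mathrm{PB}_3/\mathsf{N}_{\mathrm{PB}_3}$, $x_{12}\mapsto x_{12}^{2m+1}\mathsf{N}_{\mathrm{PB}_3}$, $x_{23}\mapsto f^{-1}x_{23}^{2m+1}f\,\mathsf{N}_{\mathrm{PB}_3}$, $c\mapsto c^{2m+1}\mathsf{N}_{\mathrm{PB}_3}$, is onto. Child's drawings. A child's drawing of degree $d$ is an $S_d$-conjugacy class $[\psi]$ of homomorphisms $\psi:\mathsf{F}_2\to S_d$ with transitive image. Its monodromy group is the subgroup $\psi(\mathsf{F}_2)\le S_d$, considered up to conjugation in $S_d$. It is subordinate to $\mathsf{N}$ if $\mathsf{N}_{\mathsf{F}_2}\le\ker(\psi)$; $\mathsf{Dessin}(\mathsf{N})$ is the set of child's drawings subordinate to $\mathsf{N}$. For $[\psi]\in\mathsf{Dessin}(\mathsf{N})$ and $[m,f]\in\mathsf{GT}(\mathsf{N})$, $[\psi]^{[m,f]}$ is the child's drawing represented by $x\mapsto\psi(x^{2m+1})$, $y\mapsto\psi(f^{-1}y^{2m+1}f)$. *)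

theory Defs
  imports "HOL-Algebra.Algebra" "HOL-Number_Theory.Cong"
begin

section \<open>Group presentations\<close>

text \<open>
  A letter \<open>(a, True)\<close> stands for the generator \<open>a\<close>, and \<open>(a, False)\<close> for its inverse.
  \<open>pres_eq S R\<close> is the least congruence on words over \<open>S\<close> that contains the relations \<open>R\<close>
  and makes \<open>(a, True)\<close> and \<open>(a, False)\<close> inverse to each other.
\<close>

inductive pres_eq ::
  "'a set \<Rightarrow> (('a \<times> bool) list \<times> ('a \<times> bool) list) set
    \<Rightarrow> ('a \<times> bool) list \<Rightarrow> ('a \<times> bool) list \<Rightarrow> bool"
  for S R where
  refl: "u \<in> lists (S \<times> UNIV) \<Longrightarrow> pres_eq S R u u"
| sym: "pres_eq S R u v \<Longrightarrow> pres_eq S R v u"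
| trans: "pres_eq S R u v \<Longrightarrow> pres_eq S R v w \<Longrightarrow> pres_eq S R u w"
| append: "pres_eq S R u u' \<Longrightarrow> pres_eq S R v v' \<Longrightarrow> pres_eq S R (u @ v) (u' @ v')"
| cancel: "a \<in> S \<Longrightarrow> pres_eq S R [(a, b), (a, \<not> b)] []"
| rel: "(u, v) \<in> R \<Longrightarrow> u \<in> lists (S \<times> UNIV) \<Longrightarrow> v \<in> lists (S \<times> UNIV) \<Longrightarrow> pres_eq S R u v"

definition pres_class ::
  "'a set \<Rightarrow> (('a \<times> bool) list \<times> ('a \<times> bool) list) set
    \<Rightarrow> ('a \<times> bool) list \<Rightarrow> ('a \<times> bool) list set" where
  "pres_class S R u = {v. pres_eq S R u v}"

definition presented_group ::
  "'a set \<Rightarrow> (('a \<times> bool) list \<times> ('a \<times> bool) list) set \<Rightarrow> ('a \<times> bool) list set monoid" where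
  "presented_group S R =
    \<lparr>carrier = pres_class S R ` lists (S \<times> UNIV),
     monoid.mult = (\<lambda>A C. \<Union>u\<in>A. \<Union>v\<in>C. pres_class S R (u @ v)),
     one = pres_class S R []\<rparr>"

lemma pres_eq_lists:
  "pres_eq S R u v \<Longrightarrow> u \<in> lists (S \<times> UNIV) \<and> v \<in> lists (S \<times> UNIV)"
  by (induction rule: pres_eq.induct) auto

lemma pres_class_eq: "pres_eq S R u v \<Longrightarrow> pres_class S R u = pres_class S R v"
  unfolding pres_class_def by (blast intro: pres_eq.sym pres_eq.trans)

lemma pres_mult:
  assumes "u \<in> lists (S \<times> UNIV)" "v \<in> lists (S \<times> UNIV)"
  shows "pres_class S R u \<otimes>\<^bsub>presented_group S R\<^esub> pres_class S R v = pres_class S R (u @ v)"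
proof -
  let ?c = "pres_class S R"
  have eq: "?c (u' @ v') = ?c (u @ v)" if "u' \<in> ?c u" "v' \<in> ?c v" for u' v'
  proof -
    have "pres_eq S R u u'" "pres_eq S R v v'" using that by (simp_all add: pres_class_def)
    from pres_class_eq[OF pres_eq.append[OF this]] show ?thesis by (rule HOL.sym)
  qed
  have mem: "u \<in> ?c u" "v \<in> ?c v"
    using assms by (simp_all add: pres_class_def pres_eq.refl)
  have "(\<Union>u'\<in>?c u. \<Union>v'\<in>?c v. ?c (u' @ v')) = ?c (u @ v)"
  proof (intro equalityI subsetI)
    fix w assume "w \<in> (\<Union>u'\<in>?c u. \<Union>v'\<in>?c v. ?c (u' @ v'))"
    then obtain u' v' where "u' \<in> ?c u" "v' \<in> ?c v" "w \<in> ?c (u' @ v')" by blast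
    then show "w \<in> ?c (u @ v)" using eq by simp
  next
    fix w assume "w \<in> ?c (u @ v)"
    then show "w \<in> (\<Union>u'\<in>?c u. \<Union>v'\<in>?c v. ?c (u' @ v'))" using mem by blast
  qed
  then show ?thesis by (simp add: presented_group_def)
qed

lemma pres_left_inverse:
  "u \<in> lists (S \<times> UNIV) \<Longrightarrow>
    pres_eq S R (rev (map (\<lambda>(a, b). (a, \<not> b)) u) @ u) []"
proof (induction u)
  case Nil
  then show ?case by (auto intro: pres_eq.refl)
next
  case (Cons l u)
  obtain a b where l: "l = (a, b)" by (cases l)
  let ?w = "rev (map (\<lambda>(a, b). (a, \<not> b)) u)"
  have a: "a \<in> S" and u: "u \<in> lists (S \<times> UNIV)" using Cons.prems l by auto
  have IH: "pres_eq S R (?w @ u) []" using Cons.IH u by simp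
  have w: "?w \<in> lists (S \<times> UNIV)" using pres_eq_lists[OF IH] by simp
  have "pres_eq S R [(a, \<not> b), (a, \<not> \<not> b)] []" by (rule pres_eq.cancel[OF a])
  from pres_eq.append[OF pres_eq.append[OF pres_eq.refl[OF w] this] pres_eq.refl[OF u]]
  have "pres_eq S R (?w @ [(a, \<not> b), (a, b)] @ u) (?w @ u)" by simp
  from pres_eq.trans[OF this IH] show ?case by (simp add: l)
qed

lemma group_presented_group: "group (presented_group S R)"
proof -
  let ?W = "lists (S \<times> (UNIV :: bool set))"
  let ?G = "presented_group S R"
  let ?c = "pres_class S R"
  have carrier: "carrier ?G = ?c ` ?W" and one: "\<one>\<^bsub>?G\<^esub> = ?c []"
    by (simp_all add: presented_group_def)
  have app: "u @ v \<in> ?W" if "u \<in> ?W" "v \<in> ?W" for u v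
    using that by (simp only: append_in_lists_conv)
  have nil: "[] \<in> ?W" by (rule lists.Nil)
  show ?thesis
  proof (rule groupI)
    show "\<one>\<^bsub>?G\<^esub> \<in> carrier ?G" unfolding carrier one using nil by (rule imageI)
  next
    fix A C assume "A \<in> carrier ?G" "C \<in> carrier ?G"
    then obtain u v where u: "u \<in> ?W" "A = ?c u" and v: "v \<in> ?W" "C = ?c v"
      unfolding carrier by blast
    show "A \<otimes>\<^bsub>?G\<^esub> C \<in> carrier ?G"
      unfolding u(2) v(2) pres_mult[OF u(1) v(1)] carrier using app[OF u(1) v(1)] by (rule imageI)
    fix E assume "E \<in> carrier ?G"
    then obtain w where w: "w \<in> ?W" "E = ?c w" unfolding carrier by blast
    show "A \<otimes>\<^bsub>?G\<^esub> C \<otimes>\<^bsub>?G\<^esub> E = A \<otimes>\<^bsub>?G\<^esub> (C \<otimes>\<^bsub>?G\<^esub> E)"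
      unfolding u(2) v(2) w(2) pres_mult[OF u(1) v(1)] pres_mult[OF v(1) w(1)]
        pres_mult[OF app[OF u(1) v(1)] w(1)] pres_mult[OF u(1) app[OF v(1) w(1)]]
      by (simp only: append_assoc)
  next
    fix A assume "A \<in> carrier ?G"
    then obtain u where u: "u \<in> ?W" "A = ?c u" unfolding carrier by blast
    show "\<one>\<^bsub>?G\<^esub> \<otimes>\<^bsub>?G\<^esub> A = A"
      unfolding u(2) one pres_mult[OF nil u(1)] by (simp only: append_Nil)
    let ?v = "rev (map (\<lambda>(a, b). (a, \<not> b)) u)"
    note li = pres_left_inverse[OF u(1), of R]
    have v: "?v \<in> ?W" using pres_eq_lists[OF li] by simp
    have "?c ?v \<otimes>\<^bsub>?G\<^esub> A = \<one>\<^bsub>?G\<^esub>"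
      unfolding u(2) one pres_mult[OF v u(1)] by (rule pres_class_eq[OF li])
    then show "\<exists>C\<in>carrier ?G. C \<otimes>\<^bsub>?G\<^esub> A = \<one>\<^bsub>?G\<^esub>"
      using v unfolding carrier by blast
  qed
qed

section \<open>Braid groups\<close>

definition group_prod :: "('a, 'b) monoid_scheme \<Rightarrow> 'a list \<Rightarrow> 'a" where
  "group_prod G gs = foldr (monoid.mult G) gs \<one>\<^bsub>G\<^esub>"

definition hom_with_values ::
  "('a, 'c) monoid_scheme \<Rightarrow> ('b, 'd) monoid_scheme \<Rightarrow> ('a \<times> 'b) list \<Rightarrow> 'a \<Rightarrow> 'b" where
  "hom_with_values G H vs =
    (THE h. h \<in> hom G H \<and> h \<in> extensional (carrier G) \<and> (\<forall>(g, a) \<in> set vs. h g = a))"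

type_synonym braid = "(nat \<times> bool) list set"

definition braid_rels :: "nat \<Rightarrow> ((nat \<times> bool) list \<times> (nat \<times> bool) list) set" where
  "braid_rels n =
     {([(i, True), (j, True)], [(j, True), (i, True)]) | i j. 1 \<le> i \<and> i + 2 \<le> j \<and> j < n} \<union>
     {([(i, True), (i + 1, True), (i, True)], [(i + 1, True), (i, True), (i + 1, True)]) | i.
        1 \<le> i \<and> i + 1 < n}"

definition Br :: "nat \<Rightarrow> braid monoid" where
  "Br n = presented_group {1..<n} (braid_rels n)"

definition sigma :: "nat \<Rightarrow> nat \<Rightarrow> braid" where
  "sigma n i = pres_class {1..<n} (braid_rels n) [(i, True)]"

definition braid_perm :: "nat \<Rightarrow> braid \<Rightarrow> nat \<Rightarrow> nat" where
  "braid_perm n =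
    hom_with_values (Br n) (sym_group n) (map (\<lambda>i. (sigma n i, transpose i (i + 1))) [1..<n])"

definition PB :: "nat \<Rightarrow> braid monoid" where
  "PB n = (Br n)\<lparr>carrier := kernel (Br n) (sym_group n) (braid_perm n)\<rparr>"

definition xgen :: "nat \<Rightarrow> nat \<Rightarrow> nat \<Rightarrow> braid" where
  "xgen n i j =
    (let t = group_prod (Br n) (map (sigma n) (rev [i + 1..<j]))
     in group_prod (Br n) [t, sigma n i [^]\<^bsub>Br n\<^esub> (2 :: nat), inv\<^bsub>Br n\<^esub> t])"

definition c3 :: braid where
  "c3 = group_prod (Br 3) [xgen 3 2 3, xgen 3 1 2, xgen 3 1 3]"

definition F2 :: "braid monoid" where
  "F2 = subgroup_generated (PB 3) {xgen 3 1 2, xgen 3 2 3}"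

section \<open>The poset \<open>NFI\<close> and the data attached to \<open>N\<close>\<close>

definition NFI_PB4 :: "braid set set" where
  "NFI_PB4 = {N. N \<lhd> Br 4 \<and> finite (rcosets\<^bsub>Br 4\<^esub> N) \<and> N \<subseteq> carrier (PB 4)}"

definition phi_hom :: "braid \<Rightarrow> braid \<Rightarrow> braid \<Rightarrow> braid \<Rightarrow> braid" where
  "phi_hom a b d =
    hom_with_values (PB 3) (PB 4) [(xgen 3 1 2, a), (xgen 3 2 3, b), (xgen 3 1 3, d)]"

definition phi_123 :: "braid \<Rightarrow> braid" where
  "phi_123 = phi_hom (xgen 4 1 2) (xgen 4 2 3) (xgen 4 1 3)"

definition phi_234 :: "braid \<Rightarrow> braid" where
  "phi_234 = phi_hom (xgen 4 2 3) (xgen 4 3 4) (xgen 4 2 4)"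

definition phi_12_3_4 :: "braid \<Rightarrow> braid" where
  "phi_12_3_4 =
    phi_hom (xgen 4 1 3 \<otimes>\<^bsub>Br 4\<^esub> xgen 4 2 3) (xgen 4 3 4) (xgen 4 1 4 \<otimes>\<^bsub>Br 4\<^esub> xgen 4 2 4)"

definition phi_1_23_4 :: "braid \<Rightarrow> braid" where
  "phi_1_23_4 =
    phi_hom (xgen 4 1 2 \<otimes>\<^bsub>Br 4\<^esub> xgen 4 1 3) (xgen 4 2 4 \<otimes>\<^bsub>Br 4\<^esub> xgen 4 3 4) (xgen 4 1 4)"

definition phi_1_2_34 :: "braid \<Rightarrow> braid" where
  "phi_1_2_34 =
    phi_hom (xgen 4 1 2) (xgen 4 2 3 \<otimes>\<^bsub>Br 4\<^esub> xgen 4 2 4) (xgen 4 1 3 \<otimes>\<^bsub>Br 4\<^esub> xgen 4 1 4)"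

definition N_PB3 :: "braid set \<Rightarrow> braid set" where
  "N_PB3 N =
    {g \<in> carrier (PB 3).
      phi_123 g \<in> N \<and> phi_234 g \<in> N \<and> phi_12_3_4 g \<in> N \<and> phi_1_23_4 g \<in> N \<and> phi_1_2_34 g \<in> N}"

text \<open>
  The library represents quotient groups by right cosets. All subgroups factored out here are
  normal, so the right coset \<open>N g\<close> is the coset \<open>g N\<close>.
\<close>

definition N_ord :: "braid set \<Rightarrow> nat" where
  "N_ord N =
    (let Q = PB 3 Mod N_PB3 N;
         order_of = (\<lambda>g. group.ord Q (N_PB3 N #>\<^bsub>PB 3\<^esub> g))
     in lcm (order_of (xgen 3 1 2)) (lcm (order_of (xgen 3 2 3)) (order_of c3)))"

definition N_F2 :: "braid set \<Rightarrow> braid set" where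
  "N_F2 N = N_PB3 N \<inter> carrier F2"

section \<open>GT-shadows\<close>

definition hexagons :: "braid set \<Rightarrow> int \<Rightarrow> braid \<Rightarrow> bool" where
  "hexagons N m f \<longleftrightarrow>
    (let B = Br 3; s1 = sigma 3 1; s2 = sigma 3 2; x = xgen 3 1 2; y = xgen 3 2 3;
         coset = (\<lambda>gs. N_PB3 N #>\<^bsub>B\<^esub> group_prod B gs)
     in coset [s1, x [^]\<^bsub>B\<^esub> m, inv\<^bsub>B\<^esub> f, s2, y [^]\<^bsub>B\<^esub> m, f]
          = coset [inv\<^bsub>B\<^esub> f, s1, s2, x [^]\<^bsub>B\<^esub> (- m), c3 [^]\<^bsub>B\<^esub> m] \<and>
        coset [inv\<^bsub>B\<^esub> f, s2, y [^]\<^bsub>B\<^esub> m, f, s1, x [^]\<^bsub>B\<^esub> m]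
          = coset [s2, s1, y [^]\<^bsub>B\<^esub> (- m), c3 [^]\<^bsub>B\<^esub> m, f])"

definition pentagon :: "braid set \<Rightarrow> braid \<Rightarrow> bool" where
  "pentagon N f \<longleftrightarrow>
    N #>\<^bsub>PB 4\<^esub> group_prod (PB 4) [phi_234 f, phi_1_23_4 f, phi_123 f]
      = N #>\<^bsub>PB 4\<^esub> group_prod (PB 4) [phi_1_2_34 f, phi_12_3_4 f]"

definition gt_hom_onto :: "braid set \<Rightarrow> int \<Rightarrow> braid \<Rightarrow> bool" where
  "gt_hom_onto N m f \<longleftrightarrow>
    (let P = PB 3; Q = P Mod N_PB3 N; x = xgen 3 1 2; y = xgen 3 2 3;
         coset = (\<lambda>g. N_PB3 N #>\<^bsub>P\<^esub> g)
     in \<exists>T \<in> hom P Q.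
          T x = coset (x [^]\<^bsub>P\<^esub> (2 * m + 1)) \<and>
          T y = coset (group_prod P [inv\<^bsub>P\<^esub> f, y [^]\<^bsub>P\<^esub> (2 * m + 1), f]) \<and>
          T c3 = coset (c3 [^]\<^bsub>P\<^esub> (2 * m + 1)) \<and>
          T ` carrier P = carrier Q)"

definition gt_class :: "braid set \<Rightarrow> int \<Rightarrow> braid \<Rightarrow> int set \<times> braid set" where
  "gt_class N m f = ({m + int (N_ord N) * k | k. True}, N_PB3 N #>\<^bsub>PB 3\<^esub> f)"

definition GT :: "braid set \<Rightarrow> (int set \<times> braid set) set" where
  "GT N =
    {gt_class N m f | m f.
      f \<in> carrier F2 \<and> hexagons N m f \<and> pentagon N f \<and>
      (\<exists>k. [(2 * m + 1) * k = 1] (mod int (N_ord N))) \<and> gt_hom_onto N m f}"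

section \<open>Child's drawings\<close>

text \<open>
  The type of homomorphisms does not record the degree, but transitivity on the nonempty set
  \<open>{1..d}\<close> determines \<open>d\<close>.
\<close>

definition dessin_hom :: "nat \<Rightarrow> (braid \<Rightarrow> nat \<Rightarrow> nat) \<Rightarrow> bool" where
  "dessin_hom d \<psi> \<longleftrightarrow>
    1 \<le> d \<and> \<psi> \<in> hom F2 (sym_group d) \<and> \<psi> \<in> extensional (carrier F2) \<and>
    (\<forall>i\<in>{1..d}. \<forall>j\<in>{1..d}. \<exists>g\<in>carrier F2. \<psi> g i = j)"

definition dessin_class :: "nat \<Rightarrow> (braid \<Rightarrow> nat \<Rightarrow> nat) \<Rightarrow> (braid \<Rightarrow> nat \<Rightarrow> nat) set" where
  "dessin_class d \<psi> =
    {\<lambda>g\<in>carrier F2. s \<otimes>\<^bsub>sym_group d\<^esub> \<psi> g \<otimes>\<^bsub>sym_group d\<^esub> inv\<^bsub>sym_group d\<^esub> s | s.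
      s \<in> carrier (sym_group d)}"

definition child_drawings :: "nat \<Rightarrow> (braid \<Rightarrow> nat \<Rightarrow> nat) set set" where
  "child_drawings d = {dessin_class d \<psi> | \<psi>. dessin_hom d \<psi>}"

definition dessin_degree :: "(braid \<Rightarrow> nat \<Rightarrow> nat) set \<Rightarrow> nat" where
  "dessin_degree D = (THE d. D \<in> child_drawings d)"

text \<open>
  As \<open>\<psi>\<close> runs through an \<open>S\<^sub>d\<close>-conjugacy class of homomorphisms, its image runs through an
  \<open>S\<^sub>d\<close>-conjugacy class of subgroups: this class is the monodromy group up to conjugation.
\<close>

definition monodromy_group :: "(braid \<Rightarrow> nat \<Rightarrow> nat) set \<Rightarrow> (nat \<Rightarrow> nat) set set" where
  "monodromy_group D = {\<psi> ` carrier F2 | \<psi>. \<psi> \<in> D}"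

definition Dessin :: "braid set \<Rightarrow> (braid \<Rightarrow> nat \<Rightarrow> nat) set set" where
  "Dessin N =
    {dessin_class d \<psi> | d \<psi>. dessin_hom d \<psi> \<and> N_F2 N \<subseteq> kernel F2 (sym_group d) \<psi>}"

definition twisted_hom ::
  "nat \<Rightarrow> (braid \<Rightarrow> nat \<Rightarrow> nat) \<Rightarrow> int \<Rightarrow> braid \<Rightarrow> braid \<Rightarrow> nat \<Rightarrow> nat" where
  "twisted_hom d \<psi> m f =
    (let x = xgen 3 1 2; y = xgen 3 2 3
     in hom_with_values F2 (sym_group d)
          [(x, \<psi> (x [^]\<^bsub>F2\<^esub> (2 * m + 1))),
           (y, \<psi> (group_prod F2 [inv\<^bsub>F2\<^esub> f, y [^]\<^bsub>F2\<^esub> (2 * m + 1), f]))])"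

text \<open>
  The child's drawing obtained from arbitrary representatives \<open>\<psi>\<close> of \<open>D\<close> and \<open>(m, f)\<close> of the
  GT-shadow; it does not depend on their choice.
\<close>

definition dessin_act ::
  "braid set \<Rightarrow> (braid \<Rightarrow> nat \<Rightarrow> nat) set \<Rightarrow> int set \<times> braid set \<Rightarrow> (braid \<Rightarrow> nat \<Rightarrow> nat) set" where
  "dessin_act N D s =
    (THE E. \<exists>\<psi> m f. \<psi> \<in> D \<and> f \<in> carrier F2 \<and> gt_class N m f = s \<and>
       E = dessin_class (dessin_degree D) (twisted_hom (dessin_degree D) \<psi> m f))"

end

theory Submission
  imports Defs
begin

text \<open>
  Reidemeister--Schreier rewriting along the six cosets of \<open>PB\<^sub>3\<close> in \<open>B\<^sub>3\<close> shows that a homomorphism from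
  \<open>PB\<^sub>3\<close> to a group is the same as a triple \<open>(a, b, d)\<close> of values of \<open>x\<^sub>1\<^sub>2, x\<^sub>2\<^sub>3, x\<^sub>1\<^sub>3\<close> with
  \<open>b a d = a d b = d b a\<close>. Hence the five homomorphisms to \<open>PB\<^sub>4\<close> exist, \<open>N\<^sub>P\<^sub>B\<^sub>3\<close> is normal, and \<open>F\<^sub>2\<close>
  is free, so \<open>x \<mapsto> x\<^sup>2\<^sup>m\<^sup>+\<^sup>1\<close>, \<open>y \<mapsto> f\<inverse> y\<^sup>2\<^sup>m\<^sup>+\<^sup>1 f\<close> defines an endomorphism \<open>\<theta>\<close> and the twisted
  homomorphism is \<open>\<psi> \<circ> \<theta>\<close>. Both parts of the theorem follow from \<open>\<psi>(\<theta>(F\<^sub>2)) = \<psi>(F\<^sub>2)\<close>. The left side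
  contains \<open>\<psi>(x)\<close> because \<open>2m + 1\<close> is a unit modulo the order of \<open>x\<close>. By condition (iv), and since
  \<open>PB\<^sub>3 = F\<^sub>2 \<langle>c\<rangle>\<close> with \<open>c\<close> central, \<open>\<psi>(f)\<close> is an element of the left side times an element that
  commutes with \<open>\<psi>(F\<^sub>2)\<close>; so the left side also contains \<open>\<psi>(y)\<close>.
\<close>

section \<open>Presented groups\<close>

lemma hom_eq_on_generate:
  assumes "group G" "group H" "h \<in> hom G H" "k \<in> hom G H" "A \<subseteq> carrier G"
    and eq: "\<And>g. g \<in> A \<Longrightarrow> h g = k g" and g: "g \<in> generate G A"
  shows "h g = k g"
proof -
  interpret h: group_hom G H h using assms by (simp add: group_hom_def group_hom_axioms_def)
  interpret k: group_hom G H k using assms by (simp add: group_hom_def group_hom_axioms_def)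
  show ?thesis using g
  proof induction
    case (inv g)
    then show ?case using eq[OF inv] assms(5) by (simp add: subset_iff)
  next
    case (eng g g')
    moreover have "g \<in> carrier G" "g' \<in> carrier G"
      using eng h.G.generate_in_carrier[OF assms(5)] by simp_all
    ultimately show ?case by simp
  qed (simp_all add: eq)
qed

text \<open>This discharges the definite description: \<open>h\<close> supplies existence, and
  uniqueness holds because the arguments listed in \<open>vs\<close> generate \<open>G\<close> and
  extensionality fixes the values outside the carrier.\<close>

lemma hom_with_values_eq:
  assumes "group G" "group H" "h \<in> hom G H"
    and "carrier G = generate G (fst ` set vs)"
    and "\<And>g a. (g, a) \<in> set vs \<Longrightarrow> h g = a"
  shows "hom_with_values G H vs = restrict h (carrier G)"
  unfolding hom_with_values_def
proof (rule the_equality)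
  have sub: "fst ` set vs \<subseteq> carrier G"
    unfolding assms(4) by (auto intro: generate.incl)
  show "restrict h (carrier G) \<in> hom G H \<and> restrict h (carrier G) \<in> extensional (carrier G) \<and>
      (\<forall>(g, a)\<in>set vs. restrict h (carrier G) g = a)"
    using assms(3,5) sub group.is_monoid[OF assms(1)]
    by (force simp: hom_def monoid.m_closed)
  fix k assume k: "k \<in> hom G H \<and> k \<in> extensional (carrier G) \<and> (\<forall>(g, a)\<in>set vs. k g = a)"
  show "k = restrict h (carrier G)"
  proof (rule extensionalityI)
    fix g assume g: "g \<in> carrier G"
    have "k g = h g"
      by (rule hom_eq_on_generate[OF assms(1,2) _ assms(3) sub])
        (use k assms(4,5) g in \<open>auto simp: split_beta\<close>)
    then show "k g = restrict h (carrier G) g" using g by simp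
  qed (use k in auto)
qed

lemma carrier_presented_group: "carrier (presented_group S R) = pres_class S R ` lists (S \<times> UNIV)"
  and one_presented_group: "\<one>\<^bsub>presented_group S R\<^esub> = pres_class S R []"
  by (simp_all add: presented_group_def)

lemma pres_class_in_carrier:
  "u \<in> lists (S \<times> UNIV) \<Longrightarrow> pres_class S R u \<in> carrier (presented_group S R)"
  by (simp add: carrier_presented_group)

lemma pres_class_inverse_letter:
  assumes "a \<in> S"
  shows "pres_class S R [(a, False)] = inv\<^bsub>presented_group S R\<^esub> pres_class S R [(a, True)]"
proof -
  interpret group "presented_group S R" by (rule group_presented_group)
  have w: "[(a, b)] \<in> lists (S \<times> UNIV)" for b using assms by auto
  have "pres_class S R [(a, False)] \<otimes>\<^bsub>presented_group S R\<^esub> pres_class S R [(a, True)] =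
      \<one>\<^bsub>presented_group S R\<^esub>"
    using pres_class_eq[OF pres_eq.cancel[OF assms, of R False]]
    by (simp add: pres_mult[OF w w] one_presented_group)
  then show ?thesis
    using pres_class_in_carrier[OF w] by (intro inv_equality[symmetric])
qed

lemma pres_class_Cons:
  assumes "l # u \<in> lists (S \<times> UNIV)"
  shows "pres_class S R (l # u) = pres_class S R [l] \<otimes>\<^bsub>presented_group S R\<^esub> pres_class S R u"
  using assms by (subst pres_mult) auto

lemma generate_presented_group:
  "carrier (presented_group S R) =
    generate (presented_group S R) ((\<lambda>a. pres_class S R [(a, True)]) ` S)" (is "_ = generate ?G ?A")
proof
  interpret group ?G by (rule group_presented_group)
  have "?A \<subseteq> carrier ?G" by (auto intro!: pres_class_in_carrier)
  then show "generate ?G ?A \<subseteq> carrier ?G" by (rule generate_incl)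
  have "pres_class S R u \<in> generate ?G ?A" if "u \<in> lists (S \<times> UNIV)" for u
    using that
  proof (induction u)
    case Nil
    then show ?case using generate.one[of ?G] by (simp add: one_presented_group)
  next
    case (Cons l u)
    obtain a b where l: "l = (a, b)" by (cases l)
    have "pres_class S R [l] \<in> generate ?G ?A"
      using Cons(1) l by (cases b) (auto simp: pres_class_inverse_letter intro: generate.incl generate.inv)
    then show ?case
      using Cons by (subst pres_class_Cons) (auto intro: generate.eng)
  qed
  then show "carrier ?G \<subseteq> generate ?G ?A" by (auto simp: carrier_presented_group)
qed

text \<open>
  The generators act on a set of states by involutions, and the letter \<open>(a, True)\<close> read in the
  state \<open>p\<close> contributes the group element \<open>w a p\<close>. With one state this is the evaluation of words
  in a group; with the cosets of a subgroup as states it is the Reidemeister--Schreier rewriting.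
\<close>

fun end_state :: "('a \<Rightarrow> 's \<Rightarrow> 's) \<Rightarrow> 's \<Rightarrow> ('a \<times> bool) list \<Rightarrow> 's" where
  "end_state act p [] = p"
| "end_state act p ((a, b) # u) = end_state act (act a p) u"

fun path_value ::
  "('g, 'c) monoid_scheme \<Rightarrow> ('a \<Rightarrow> 's \<Rightarrow> 's) \<Rightarrow> ('a \<Rightarrow> 's \<Rightarrow> 'g) \<Rightarrow> 's \<Rightarrow> ('a \<times> bool) list \<Rightarrow> 'g" where
  "path_value G act w p [] = \<one>\<^bsub>G\<^esub>"
| "path_value G act w p ((a, b) # u) =
    (if b then w a p else inv\<^bsub>G\<^esub> w a (act a p)) \<otimes>\<^bsub>G\<^esub> path_value G act w (act a p) u"

lemma end_state_append: "end_state act p (u @ v) = end_state act (end_state act p u) v"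
  by (induction act p u rule: end_state.induct) auto

lemma (in group) path_value_closed:
  assumes "\<And>a p. w a p \<in> carrier G"
  shows "path_value G act w p u \<in> carrier G"
proof (induction act p u rule: end_state.induct)
  case (2 act p a b u)
  then show ?case using assms by simp
qed simp

lemma (in group) path_value_append:
  assumes "\<And>a p. w a p \<in> carrier G"
  shows "path_value G act w p (u @ v) =
    path_value G act w p u \<otimes> path_value G act w (end_state act p u) v"
proof (induction act p u rule: end_state.induct)
  case (2 act p a b u)
  then show ?case using assms by (simp add: m_assoc path_value_closed)
qed (use assms in \<open>simp add: path_value_closed\<close>)

text \<open>Induction on the congruence. \<open>end_state\<close> ignores the sign of a letter, so a
  letter followed by its inverse returns to \<open>p\<close> because \<open>act a\<close> is an
  involution. The inverse letter runs the same edge backwards, which is why its weight is the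
  inverse of the one at \<open>act a p\<close>.\<close>

lemma (in group) path_value_respects:
  assumes w: "\<And>a p. w a p \<in> carrier G"
    and involution: "\<And>a p. act a (act a p) = p"
    and rel: "\<And>u v p. (u, v) \<in> R \<Longrightarrow> end_state act p u = end_state act p v \<and>
      path_value G act w p u = path_value G act w p v"
    and "pres_eq S R u v"
  shows "end_state act p u = end_state act p v \<and> path_value G act w p u = path_value G act w p v"
  using assms(4)
proof (induction arbitrary: p)
  case (append u u' v v')
  then show ?case by (simp add: end_state_append path_value_append[OF w])
next
  case (cancel a b)
  then show ?case using w by (cases b) (simp_all add: involution)
qed (auto simp: rel)

text \<open>The universal property of a presentation: \<open>path_value_respects\<close> with a
  single state makes the evaluation independent of the word picked from a class.\<close>

lemma presented_group_hom_exists: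
  assumes "group G" and f: "\<And>a. f a \<in> carrier G"
    and rel: "\<And>u v. (u, v) \<in> R \<Longrightarrow> path_value G (\<lambda>a p. p) (\<lambda>a p. f a) () u =
      path_value G (\<lambda>a p. p) (\<lambda>a p. f a) () v"
  obtains h where "h \<in> hom (presented_group S R) G"
    and "\<And>a. a \<in> S \<Longrightarrow> h (pres_class S R [(a, True)]) = f a"
proof -
  interpret group G by fact
  let ?ev = "path_value G (\<lambda>a p. p) (\<lambda>a p. f a) ()"
  define h where "h A = ?ev (SOME u. u \<in> A)" for A
  have h: "h (pres_class S R u) = ?ev u" if "u \<in> lists (S \<times> UNIV)" for u
  proof -
    have "u \<in> pres_class S R u" using that by (simp add: pres_class_def pres_eq.refl)
    then have "(SOME v. v \<in> pres_class S R u) \<in> pres_class S R u" by (rule someI)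
    then have "pres_eq S R u (SOME v. v \<in> pres_class S R u)" by (simp add: pres_class_def)
    from path_value_respects[OF _ _ _ this, of "\<lambda>a p. f a" "\<lambda>a p. p" "()"]
    show ?thesis unfolding h_def using f rel by simp
  qed
  show thesis
  proof
    show "h \<in> hom (presented_group S R) G"
      by (auto simp: hom_def Pi_iff carrier_presented_group h pres_mult path_value_append
          path_value_closed f append_in_lists_conv simp del: in_lists_conv_set)
    show "h (pres_class S R [(a, True)]) = f a" if "a \<in> S" for a
      using that f by (subst h) auto
  qed
qed

section \<open>Braid groups\<close>

lemma group_Br: "group (Br n)"
  by (simp add: Br_def group_presented_group)

lemma generate_Br: "carrier (Br n) = generate (Br n) (sigma n ` {1..<n})"
  using generate_presented_group[of "{1..<n}" "braid_rels n"] by (simp add: Br_def sigma_def[abs_def])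

lemma sigma_closed: "i \<in> {1..<n} \<Longrightarrow> sigma n i \<in> carrier (Br n)"
  unfolding Br_def sigma_def by (rule pres_class_in_carrier) auto

lemma braid_relation_eq:
  assumes "(u, v) \<in> braid_rels n"
  shows "pres_class {1..<n} (braid_rels n) u = pres_class {1..<n} (braid_rels n) v"
  using assms by (intro pres_class_eq pres_eq.rel) (auto simp: braid_rels_def)

lemma sigma_commute:
  assumes "1 \<le> i" "i + 2 \<le> j" "j < n"
  shows "sigma n i \<otimes>\<^bsub>Br n\<^esub> sigma n j = sigma n j \<otimes>\<^bsub>Br n\<^esub> sigma n i"
  unfolding Br_def sigma_def
  using assms braid_relation_eq[of "[(i, True), (j, True)]" "[(j, True), (i, True)]" n]
  by (subst (1 2) pres_mult) (auto simp: braid_rels_def)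

lemma sigma_braid:
  assumes "1 \<le> i" "i + 1 < n"
  shows "sigma n i \<otimes>\<^bsub>Br n\<^esub> (sigma n (i + 1) \<otimes>\<^bsub>Br n\<^esub> sigma n i) =
    sigma n (i + 1) \<otimes>\<^bsub>Br n\<^esub> (sigma n i \<otimes>\<^bsub>Br n\<^esub> sigma n (i + 1))"
proof -
  have "([(i, True), (i + 1, True), (i, True)], [(i + 1, True), (i, True), (i + 1, True)]) \<in> braid_rels n"
    using assms unfolding braid_rels_def by blast
  from braid_relation_eq[OF this] show ?thesis
    unfolding Br_def sigma_def using assms by (simp add: pres_mult)
qed

lemma transpose_in_sym_group: "i \<in> {1..<n} \<Longrightarrow> transpose i (i + 1) \<in> carrier (sym_group n)"
  by (auto simp: sym_group_carrier intro!: permutes_swap_id)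

lemma braid_perm_hom: "braid_perm n \<in> hom (Br n) (sym_group n)"
  and braid_perm_sigma: "i \<in> {1..<n} \<Longrightarrow> braid_perm n (sigma n i) = transpose i (i + 1)"
proof -
  interpret S: group "sym_group n" by (rule sym_group_is_group)
  \<comment> \<open>\<open>id\<close> is a default for letters that are not generators:
    \<open>presented_group_hom_exists\<close> asks for a value in the group at every letter.\<close>
  let ?f = "\<lambda>i. if i \<in> {1..<n} then transpose i (i + 1) else id"
  have f: "?f i \<in> carrier (sym_group n)" for i
    using transpose_in_sym_group[of i n] S.one_closed by (simp add: sym_group_one)
  have rel: "path_value (sym_group n) (\<lambda>a p. p) (\<lambda>a p. ?f a) () u =
      path_value (sym_group n) (\<lambda>a p. p) (\<lambda>a p. ?f a) () v" if "(u, v) \<in> braid_rels n" for u v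
    using that unfolding braid_rels_def
    by (auto simp: sym_group_mult sym_group_one fun_eq_iff transpose_def)
  obtain h where h: "h \<in> hom (Br n) (sym_group n)" "\<And>i. i \<in> {1..<n} \<Longrightarrow> h (sigma n i) = ?f i"
    using presented_group_hom_exists[OF sym_group_is_group f rel, of _ "{1..<n}"]
    unfolding Br_def sigma_def by blast
  have eq: "braid_perm n = restrict h (carrier (Br n))"
    unfolding braid_perm_def
    by (rule hom_with_values_eq[OF group_Br sym_group_is_group h(1)])
      (use generate_Br[of n] h(2) in \<open>auto simp: image_image\<close>)
  show "braid_perm n \<in> hom (Br n) (sym_group n)"
    unfolding eq using h(1) group.is_monoid[OF group_Br] by (auto simp: hom_def monoid.m_closed)
  show "braid_perm n (sigma n i) = transpose i (i + 1)" if "i \<in> {1..<n}"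
    using that h(2) by (simp add: eq sigma_closed)
qed

lemma group_hom_braid_perm: "group_hom (Br n) (sym_group n) (braid_perm n)"
  by (simp add: group_hom_def group_hom_axioms_def group_Br sym_group_is_group braid_perm_hom)

lemma carrier_PB: "carrier (PB n) = kernel (Br n) (sym_group n) (braid_perm n)"
  by (simp add: PB_def)

lemma subgroup_PB: "subgroup (carrier (PB n)) (Br n)"
  unfolding carrier_PB by (rule group_hom.subgroup_kernel[OF group_hom_braid_perm])

lemma group_PB: "group (PB n)"
  using subgroup.subgroup_is_group[OF subgroup_PB group_Br] by (simp add: PB_def)

lemma mult_PB [simp]: "monoid.mult (PB n) = monoid.mult (Br n)"
  and one_PB [simp]: "one (PB n) = one (Br n)"
  by (simp_all add: PB_def)

lemma generate_PB: "A \<subseteq> carrier (PB n) \<Longrightarrow> generate (PB n) A = generate (Br n) A"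
  using group.generate_consistent[OF group_Br _ subgroup_PB] by (simp add: PB_def)

section \<open>The pure braid group on three strands\<close>

declare One_nat_def [simp del]

text \<open>In a group the two equations say exactly that the product \<open>b a d\<close> commutes
  with \<open>a\<close>, \<open>b\<close> and \<open>d\<close>. For \<open>x12\<close>,
  \<open>x23\<close>, \<open>x13\<close> in place of \<open>a\<close>, \<open>b\<close>,
  \<open>d\<close> this product is \<open>c3\<close>.\<close>

definition PB3_relations :: "('g, 'c) monoid_scheme \<Rightarrow> 'g \<Rightarrow> 'g \<Rightarrow> 'g \<Rightarrow> bool" where
  "PB3_relations G a b d \<longleftrightarrow> a \<in> carrier G \<and> b \<in> carrier G \<and> d \<in> carrier G \<and>
    b \<otimes>\<^bsub>G\<^esub> (a \<otimes>\<^bsub>G\<^esub> d) = a \<otimes>\<^bsub>G\<^esub> (d \<otimes>\<^bsub>G\<^esub> b) \<and> a \<otimes>\<^bsub>G\<^esub> (d \<otimes>\<^bsub>G\<^esub> b) = d \<otimes>\<^bsub>G\<^esub> (b \<otimes>\<^bsub>G\<^esub> a)"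

text \<open>The constructors name the coset representatives \<open>1, \<sigma>\<^sub>1, \<sigma>\<^sub>2, \<sigma>\<^sub>1\<sigma>\<^sub>2, \<sigma>\<^sub>2\<sigma>\<^sub>1, \<sigma>\<^sub>1\<sigma>\<^sub>2\<sigma>\<^sub>1\<close> of \<open>PB\<^sub>3\<close>.\<close>

datatype coset3 = C0 | C1 | C2 | C12 | C21 | C121

text \<open>The action of \<open>sigma 3 i\<close> on the right cosets of \<open>PB 3\<close> by
  right multiplication. Any index other than 1 counts as 2, so that \<open>next3 i\<close> is an
  involution for every \<open>i\<close>.\<close>

fun next3 :: "nat \<Rightarrow> coset3 \<Rightarrow> coset3" where
  "next3 i C0 = (if i = 1 then C1 else C2)"
| "next3 i C1 = (if i = 1 then C0 else C12)"
| "next3 i C2 = (if i = 1 then C21 else C0)"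
| "next3 i C12 = (if i = 1 then C121 else C1)"
| "next3 i C21 = (if i = 1 then C2 else C121)"
| "next3 i C121 = (if i = 1 then C12 else C21)"

fun rep3 :: "coset3 \<Rightarrow> braid" where
  "rep3 C0 = \<one>\<^bsub>Br 3\<^esub>"
| "rep3 C1 = sigma 3 1"
| "rep3 C2 = sigma 3 2"
| "rep3 C12 = sigma 3 1 \<otimes>\<^bsub>Br 3\<^esub> sigma 3 2"
| "rep3 C21 = sigma 3 2 \<otimes>\<^bsub>Br 3\<^esub> sigma 3 1"
| "rep3 C121 = sigma 3 1 \<otimes>\<^bsub>Br 3\<^esub> (sigma 3 2 \<otimes>\<^bsub>Br 3\<^esub> sigma 3 1)"

text \<open>
  The Schreier generator \<open>rep3 p \<sigma>\<^sub>i (rep3 (next3 i p))\<inverse>\<close> in terms of \<open>a = x\<^sub>1\<^sub>2\<close>, \<open>b = x\<^sub>2\<^sub>3\<close>,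
  \<open>d = x\<^sub>1\<^sub>3\<close>. The braid relation, read from the six states, amounts to \<open>PB3_relations\<close>.
\<close>

fun weight3 :: "('g, 'c) monoid_scheme \<Rightarrow> 'g \<Rightarrow> 'g \<Rightarrow> 'g \<Rightarrow> nat \<Rightarrow> coset3 \<Rightarrow> 'g" where
  "weight3 G a b d i C0 = \<one>\<^bsub>G\<^esub>"
| "weight3 G a b d i C1 = (if i = 1 then a else \<one>\<^bsub>G\<^esub>)"
| "weight3 G a b d i C2 = (if i = 1 then \<one>\<^bsub>G\<^esub> else b)"
| "weight3 G a b d i C12 = (if i = 1 then \<one>\<^bsub>G\<^esub> else a \<otimes>\<^bsub>G\<^esub> (d \<otimes>\<^bsub>G\<^esub> inv\<^bsub>G\<^esub> a))"
| "weight3 G a b d i C21 = (if i = 1 then d else \<one>\<^bsub>G\<^esub>)"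
| "weight3 G a b d i C121 = (if i = 1 then b else a)"

lemma next3_involution: "next3 i (next3 i p) = p"
  by (cases p) auto

lemma (in group) weight3_closed:
  "a \<in> carrier G \<Longrightarrow> b \<in> carrier G \<Longrightarrow> d \<in> carrier G \<Longrightarrow> weight3 G a b d i p \<in> carrier G"
  by (cases p) auto

lemma braid_rels_3: "braid_rels 3 = {([(1, True), (2, True), (1, True)], [(2, True), (1, True), (2, True)])}"
proof -
  have "1 \<le> i \<and> i + 1 < 3 \<longleftrightarrow> i = 1" for i :: nat by arith
  moreover have "\<not> (1 \<le> i \<and> i + 2 \<le> j \<and> j < 3)" for i j :: nat by arith
  ultimately show ?thesis unfolding braid_rels_def by (simp only:) simp
qed

lemma (in group) path_value3_respects:
  assumes G: "PB3_relations G a b d" and eq: "pres_eq {1..<3} (braid_rels 3) u v"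
  shows "end_state next3 p u = end_state next3 p v \<and>
    path_value G next3 (weight3 G a b d) p u = path_value G next3 (weight3 G a b d) p v"
proof (rule path_value_respects[OF _ _ _ eq])
  have c: "a \<in> carrier G" "b \<in> carrier G" "d \<in> carrier G"
    and r: "b \<otimes> (a \<otimes> d) = d \<otimes> (b \<otimes> a)" "a \<otimes> (d \<otimes> b) = d \<otimes> (b \<otimes> a)"
    using G by (auto simp: PB3_relations_def)
  \<comment> \<open>Only two states impose a condition. Read from \<open>C121\<close> the two sides
    are \<open>b a d\<close> and \<open>a d b\<close>; read from \<open>C21\<close> they are
    \<open>d b\<close> and \<open>b a d a^-1\<close>, for which this equation is prepared.\<close>
  have "b \<otimes> (a \<otimes> (d \<otimes> inv a)) = d \<otimes> (b \<otimes> a) \<otimes> inv a"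
    using c by (simp add: m_assoc flip: r)
  then have r': "b \<otimes> (a \<otimes> (d \<otimes> inv a)) = d \<otimes> b"
    using c by (simp add: m_assoc)
  fix u v p assume "(u, v) \<in> braid_rels 3"
  then have uv: "u = [(1, True), (2, True), (1, True)]" "v = [(2, True), (1, True), (2, True)]"
    by (simp_all add: braid_rels_3)
  show "end_state next3 p u = end_state next3 p v \<and>
    path_value G next3 (weight3 G a b d) p u = path_value G next3 (weight3 G a b d) p v"
    unfolding uv using c r r' by (cases p) (simp_all add: m_assoc)
next
  show "weight3 G a b d i q \<in> carrier G" for i q
    using G by (simp add: PB3_relations_def weight3_closed)
qed (rule next3_involution)

section \<open>Which words represent pure braids\<close>

fun perm3 :: "coset3 \<Rightarrow> nat \<Rightarrow> nat" where
  "perm3 C0 = id"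
| "perm3 C1 = transpose 1 2"
| "perm3 C2 = transpose 2 3"
| "perm3 C12 = transpose 1 2 \<circ> transpose 2 3"
| "perm3 C21 = transpose 2 3 \<circ> transpose 1 2"
| "perm3 C121 = transpose 1 2 \<circ> transpose 2 3 \<circ> transpose 1 2"

lemma perm3_next3:
  assumes "i \<in> {1..<3}"
  shows "perm3 (next3 i p) = perm3 p \<circ> transpose i (i + 1)"
proof -
  \<comment> \<open>The names hide the transpositions, so that the cases are settled by rewriting
    with \<open>s^2 = t^2 = id\<close> and the braid relation; the primed facts apply these in front
    of a further factor.\<close>
  define s t :: "nat \<Rightarrow> nat" where "s = transpose 1 2" and "t = transpose 2 3"
  have inv: "s \<circ> s = id" "t \<circ> t = id" by (simp_all add: s_def t_def)
  have sts: "s \<circ> (t \<circ> s) = t \<circ> (s \<circ> t)" by (auto simp: s_def t_def fun_eq_iff transpose_def)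
  have inv': "s \<circ> (s \<circ> f) = f" "t \<circ> (t \<circ> f) = f" for f :: "nat \<Rightarrow> nat"
    by (simp_all add: inv flip: o_assoc[symmetric])
  have sts': "s \<circ> (t \<circ> (s \<circ> f)) = t \<circ> (s \<circ> (t \<circ> f))" for f :: "nat \<Rightarrow> nat"
    using arg_cong[OF sts, of "\<lambda>g. g \<circ> f"] by (simp only: o_assoc)
  have p: "perm3 C1 = s" "perm3 C2 = t" "perm3 C12 = s \<circ> t" "perm3 C21 = t \<circ> s"
    "perm3 C121 = s \<circ> (t \<circ> s)" by (simp_all add: s_def t_def o_assoc)
  consider "i = 1" "transpose i (i + 1) = s" | "i = 2" "transpose i (i + 1) = t"
  proof -
    have "i = 1 \<or> i = 2" using assms by auto
    then show thesis using that by (auto simp: s_def t_def)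
  qed
  then show ?thesis
    by cases (cases p; simp add: p inv inv' sts sts' comp_assoc del: perm3.simps(2-6))+
qed

lemma perm3_eq_id: "perm3 p = id \<Longrightarrow> p = C0"
proof -
  assume "perm3 p = id"
  then have "perm3 p 1 = 1" "perm3 p 2 = 2" by simp_all
  then show "p = C0" by (cases p) (simp_all add: transpose_def)
qed

abbreviation class3 :: "(nat \<times> bool) list \<Rightarrow> braid" where
  "class3 \<equiv> pres_class {1..<3} (braid_rels 3)"

abbreviation words3 :: "(nat \<times> bool) list set" where
  "words3 \<equiv> lists ({1..<3} \<times> UNIV)"

lemma class3_Cons:
  assumes "(i, b) # u \<in> words3"
  shows "class3 ((i, b) # u) = (if b then sigma 3 i else inv\<^bsub>Br 3\<^esub> sigma 3 i) \<otimes>\<^bsub>Br 3\<^esub> class3 u"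
  using assms by (subst pres_class_Cons) (auto simp: Br_def sigma_def pres_class_inverse_letter)

lemma carrier_Br3: "carrier (Br 3) = class3 ` words3"
  by (simp add: Br_def carrier_presented_group)

lemma class3_closed: "u \<in> words3 \<Longrightarrow> class3 u \<in> carrier (Br 3)"
  by (simp add: carrier_Br3)

lemma class3_Nil: "class3 [] = \<one>\<^bsub>Br 3\<^esub>"
  by (simp add: Br_def one_presented_group)

text \<open>Reading a letter multiplies the permutation on the right, just as it moves the coset.
  The sign of the letter does not matter because a transposition is its own inverse.\<close>

lemma perm3_end_state:
  assumes "u \<in> words3"
  shows "perm3 (end_state next3 p u) = perm3 p \<circ> braid_perm 3 (class3 u)"
proof -
  interpret group_hom "Br 3" "sym_group 3" "braid_perm 3" by (rule group_hom_braid_perm)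
  show ?thesis using assms
  proof (induction u arbitrary: p)
    case Nil
    then show ?case using hom_one unfolding class3_Nil by (simp add: sym_group_one)
  next
    case (Cons l u)
    obtain i b where l: "l = (i, b)" by (cases l)
    have i: "i \<in> {1..<3}" using Cons(1) l by auto
    have "inv\<^bsub>sym_group 3\<^esub> transpose i (i + 1) = transpose i (i + 1)"
      using i transpose_in_sym_group by (intro H.inv_equality) (simp_all add: sym_group_mult sym_group_one)
    then have "braid_perm 3 (if b then sigma 3 i else inv\<^bsub>Br 3\<^esub> sigma 3 i) = transpose i (i + 1)"
      using i by (simp add: sigma_closed braid_perm_sigma)
    then have "braid_perm 3 (class3 (l # u)) = transpose i (i + 1) \<circ> braid_perm 3 (class3 u)"
      using Cons l i by (simp add: class3_Cons class3_closed sigma_closed sym_group_mult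
          del: in_lists_conv_set)
    then show ?case
      using Cons.IH[of "next3 i p"] l perm3_next3[OF i] by (simp add: o_assoc)
  qed
qed

text \<open>Purity is read off from the coset reached from \<open>C0\<close>: among the six states
  only \<open>C0\<close> has trivial permutation.\<close>

lemma in_PB3_iff:
  assumes "u \<in> words3"
  shows "class3 u \<in> carrier (PB 3) \<longleftrightarrow> end_state next3 C0 u = C0"
proof -
  have "braid_perm 3 (class3 u) = perm3 (end_state next3 C0 u)"
    using perm3_end_state[OF assms] by simp
  then show ?thesis
    using class3_closed[OF assms] perm3_eq_id by (auto simp: carrier_PB kernel_def sym_group_one)
qed

section \<open>The universal property of the pure braid group on three strands\<close>

lemma (in group) pow_two: "g \<in> carrier G \<Longrightarrow> g [^] (2 :: nat) = g \<otimes> g"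
  by (simp add: numeral_2_eq_2)

lemma xgen_adjacent:
  assumes "i \<in> {1..<n}"
  shows "xgen n i (i + 1) = sigma n i \<otimes>\<^bsub>Br n\<^esub> sigma n i"
proof -
  interpret group "Br n" by (rule group_Br)
  show ?thesis using sigma_closed[OF assms] by (simp add: xgen_def group_prod_def pow_two)
qed

lemma xgen3_12: "xgen 3 1 2 = sigma 3 1 \<otimes>\<^bsub>Br 3\<^esub> sigma 3 1"
  and xgen3_23: "xgen 3 2 3 = sigma 3 2 \<otimes>\<^bsub>Br 3\<^esub> sigma 3 2"
  using xgen_adjacent[of 1 3] xgen_adjacent[of 2 3] by simp_all

lemma xgen3_13:
  "xgen 3 1 3 = sigma 3 2 \<otimes>\<^bsub>Br 3\<^esub> (sigma 3 1 \<otimes>\<^bsub>Br 3\<^esub> (sigma 3 1 \<otimes>\<^bsub>Br 3\<^esub> inv\<^bsub>Br 3\<^esub> sigma 3 2))"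
proof -
  interpret group "Br 3" by (rule group_Br)
  have "[1 + 1..<3] = [2::nat]" by (simp add: upt_rec)
  then show ?thesis
    using sigma_closed[of 1 3] sigma_closed[of 2 3]
    by (simp add: xgen_def group_prod_def pow_two m_assoc Let_def)
qed

lemma xgen3_class3:
  "xgen 3 1 2 = class3 [(1, True), (1, True)]"
  "xgen 3 2 3 = class3 [(2, True), (2, True)]"
  "xgen 3 1 3 = class3 [(2, True), (1, True), (1, True), (2, False)]"
proof -
  interpret group "Br 3" by (rule group_Br)
  show "xgen 3 1 2 = class3 [(1, True), (1, True)]"
    "xgen 3 2 3 = class3 [(2, True), (2, True)]"
    "xgen 3 1 3 = class3 [(2, True), (1, True), (1, True), (2, False)]"
    using sigma_closed[of 1 3] sigma_closed[of 2 3]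
    by (simp_all add: xgen3_12 xgen3_23 xgen3_13 class3_Cons class3_Nil)
qed

lemma xgen3_in_PB3: "xgen 3 1 2 \<in> carrier (PB 3)" "xgen 3 2 3 \<in> carrier (PB 3)" "xgen 3 1 3 \<in> carrier (PB 3)"
  unfolding xgen3_class3 by (subst in_PB3_iff; simp)+

text \<open>The homomorphism multiplies the Schreier weights met by any representing word started at
  \<open>C0\<close>; \<open>PB3_relations\<close> makes the result independent of the word.\<close>

lemma PB3_hom_exists:
  assumes "group G" and G: "PB3_relations G a b d"
  obtains h where "h \<in> hom (PB 3) G" "h (xgen 3 1 2) = a" "h (xgen 3 2 3) = b" "h (xgen 3 1 3) = d"
proof -
  interpret group G by fact
  let ?w = "weight3 G a b d"
  have c: "a \<in> carrier G" "b \<in> carrier G" "d \<in> carrier G" using G by (auto simp: PB3_relations_def)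
  have w: "?w i p \<in> carrier G" for i p using c by (rule weight3_closed)
  let ?ev = "path_value G next3 ?w C0"
  define h where "h A = ?ev (SOME u. u \<in> A)" for A
  have h: "h (class3 u) = ?ev u" if "u \<in> words3" for u
  proof -
    have "u \<in> class3 u" using that by (simp add: pres_class_def pres_eq.refl)
    then have "(SOME v. v \<in> class3 u) \<in> class3 u" by (rule someI)
    then have "pres_eq {1..<3} (braid_rels 3) u (SOME v. v \<in> class3 u)" by (simp add: pres_class_def)
    from path_value3_respects[OF G this] show ?thesis unfolding h_def by simp
  qed
  have "h \<in> hom (PB 3) G"
    unfolding hom_def
  proof (intro CollectI conjI Pi_I ballI)
    fix A assume "A \<in> carrier (PB 3)"
    then obtain u where u: "u \<in> words3" "A = class3 u"
      using subgroup.subset[OF subgroup_PB[of 3]] by (auto simp: carrier_Br3)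
    then show "h A \<in> carrier G" using w by (simp only: h path_value_closed)
    fix B assume "B \<in> carrier (PB 3)"
    then obtain v where v: "v \<in> words3" "B = class3 v"
      using subgroup.subset[OF subgroup_PB[of 3]] by (auto simp: carrier_Br3)
    \<comment> \<open>A pure first factor leads back to \<open>C0\<close>, so the second word is
      again read from \<open>C0\<close>; this makes \<open>h\<close> multiplicative.\<close>
    have "end_state next3 C0 u = C0" using \<open>A \<in> carrier (PB 3)\<close> u in_PB3_iff by simp
    moreover have "A \<otimes>\<^bsub>PB 3\<^esub> B = class3 (u @ v)" unfolding u v using u v by (simp add: Br_def pres_mult)
    moreover have "u @ v \<in> words3" using u v by simp
    ultimately show "h (A \<otimes>\<^bsub>PB 3\<^esub> B) = h A \<otimes>\<^bsub>G\<^esub> h B"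
      using u v by (simp only: h path_value_append[OF w])
  qed
  moreover have "h (xgen 3 1 2) = a" "h (xgen 3 2 3) = b" "h (xgen 3 1 3) = d"
    unfolding xgen3_class3 using c by (subst h; simp)+
  ultimately show thesis using that by blast
qed

section \<open>Schreier generators of the pure braid group on three strands\<close>

lemma (in group) braid_relation_shift:
  assumes "s \<in> carrier G" "t \<in> carrier G" "s \<otimes> (t \<otimes> s) = t \<otimes> (s \<otimes> t)" "z \<in> carrier G"
  shows "s \<otimes> (t \<otimes> (s \<otimes> z)) = t \<otimes> (s \<otimes> (t \<otimes> z))"
  using arg_cong[OF assms(3), of "\<lambda>g. g \<otimes> z"] assms(1,2,4) by (simp add: m_assoc)

lemma (in group) cancel_left:
  assumes "s \<in> carrier G" "z \<in> carrier G"
  shows "s \<otimes> (inv s \<otimes> z) = z" "inv s \<otimes> (s \<otimes> z) = z"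
  using assms by (simp_all flip: m_assoc)

text \<open>For \<open>a = s^2\<close> and \<open>d = t s^2 t^-1\<close> this reads
  \<open>(a d a^-1) s = s t t\<close>. It is the step from the coset \<open>C12\<close> along
  \<open>sigma 3 2\<close> and explains the weight found there.\<close>

lemma (in group) braid_conjugate_square:
  assumes c: "s \<in> carrier G" "t \<in> carrier G" and r: "s \<otimes> (t \<otimes> s) = t \<otimes> (s \<otimes> t)"
  shows "s \<otimes> (s \<otimes> (t \<otimes> (s \<otimes> (s \<otimes> (inv t \<otimes> inv s))))) = s \<otimes> (t \<otimes> t)"
proof -
  note r' = braid_relation_shift[OF c r]
  have "s \<otimes> (s \<otimes> (t \<otimes> (s \<otimes> (s \<otimes> (inv t \<otimes> inv s))))) =
      s \<otimes> (t \<otimes> (s \<otimes> (t \<otimes> (s \<otimes> (inv t \<otimes> inv s)))))"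
    using c by (simp add: r'[of "s \<otimes> (inv t \<otimes> inv s)"])
  also have "\<dots> = s \<otimes> (t \<otimes> (t \<otimes> (s \<otimes> (t \<otimes> (inv t \<otimes> inv s)))))"
    using c by (simp add: r'[of "inv t \<otimes> inv s"])
  also have "\<dots> = s \<otimes> (t \<otimes> t)"
    using c by (simp add: cancel_left)
  finally show ?thesis .
qed

lemma rep3_step:
  assumes i: "i \<in> {1..<3}"
  shows "rep3 p \<otimes>\<^bsub>Br 3\<^esub> sigma 3 i =
    weight3 (Br 3) (xgen 3 1 2) (xgen 3 2 3) (xgen 3 1 3) i p \<otimes>\<^bsub>Br 3\<^esub> rep3 (next3 i p)"
proof -
  interpret group "Br 3" by (rule group_Br)
  have c: "sigma 3 1 \<in> carrier (Br 3)" "sigma 3 2 \<in> carrier (Br 3)" by (simp_all add: sigma_closed)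
  have r: "sigma 3 1 \<otimes>\<^bsub>Br 3\<^esub> (sigma 3 2 \<otimes>\<^bsub>Br 3\<^esub> sigma 3 1) =
      sigma 3 2 \<otimes>\<^bsub>Br 3\<^esub> (sigma 3 1 \<otimes>\<^bsub>Br 3\<^esub> sigma 3 2)"
    using sigma_braid[of 1 3] by simp
  note r' = braid_relation_shift[OF c r]
  have i: "i = 1 \<or> i = 2" using i by auto
  note S = xgen3_12 xgen3_23 xgen3_13 m_assoc inv_mult_group cancel_left
  show ?thesis
  proof (cases p)
    case C12
    then show ?thesis using i c r r' braid_conjugate_square[OF c r]
      by (auto simp: S)
  qed (use i c r r' in \<open>auto simp: S simp del: One_nat_def\<close>)
qed

lemma rep3_closed: "rep3 p \<in> carrier (Br 3)"
proof -
  interpret group "Br 3" by (rule group_Br)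
  show ?thesis by (cases p) (simp_all add: sigma_closed)
qed

text \<open>\<open>rep3_step\<close> telescopes along the word: the weights collect on the left
  while the representative is pushed to the right.\<close>

lemma rep3_class3:
  fixes w
  defines "w \<equiv> weight3 (Br 3) (xgen 3 1 2) (xgen 3 2 3) (xgen 3 1 3)"
  assumes "u \<in> words3"
  shows "rep3 p \<otimes>\<^bsub>Br 3\<^esub> class3 u =
    path_value (Br 3) next3 w p u \<otimes>\<^bsub>Br 3\<^esub> rep3 (end_state next3 p u)"
proof -
  interpret group "Br 3" by (rule group_Br)
  have w: "w i p \<in> carrier (Br 3)" for i p
    unfolding w_def using xgen3_in_PB3 subgroup.subset[OF subgroup_PB] by (auto intro!: weight3_closed)
  show ?thesis using assms(2)
  proof (induction u arbitrary: p)
    case Nil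
    then show ?case by (simp add: class3_Nil rep3_closed)
  next
    case (Cons l u)
    obtain i b where l: "l = (i, b)" by (cases l)
    have i: "i \<in> {1..<3}" using Cons(1) l by auto
    note c = sigma_closed[OF i] rep3_closed w class3_closed[OF Cons(2)] path_value_closed[of w, OF w]
    have step: "rep3 q \<otimes>\<^bsub>Br 3\<^esub> sigma 3 i = w i q \<otimes>\<^bsub>Br 3\<^esub> rep3 (next3 i q)" for q
      unfolding w_def by (rule rep3_step[OF i])
    let ?v = "if b then w i p else inv\<^bsub>Br 3\<^esub> w i (next3 i p)"
    let ?g = "if b then sigma 3 i else inv\<^bsub>Br 3\<^esub> sigma 3 i"
    \<comment> \<open>For an inverse letter, the step that starts at \<open>next3 i p\<close> and
      leads to \<open>p\<close> is solved for \<open>rep3 p\<close>.\<close>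
    have "rep3 p \<otimes>\<^bsub>Br 3\<^esub> inv\<^bsub>Br 3\<^esub> sigma 3 i = inv\<^bsub>Br 3\<^esub> w i (next3 i p) \<otimes>\<^bsub>Br 3\<^esub> rep3 (next3 i p)"
    proof -
      have "rep3 p = inv\<^bsub>Br 3\<^esub> w i (next3 i p) \<otimes>\<^bsub>Br 3\<^esub> (w i (next3 i p) \<otimes>\<^bsub>Br 3\<^esub> rep3 p)"
        using c by (simp add: cancel_left)
      also have "w i (next3 i p) \<otimes>\<^bsub>Br 3\<^esub> rep3 p = rep3 (next3 i p) \<otimes>\<^bsub>Br 3\<^esub> sigma 3 i"
        using step[of "next3 i p"] by (simp add: next3_involution)
      finally have "rep3 p = inv\<^bsub>Br 3\<^esub> w i (next3 i p) \<otimes>\<^bsub>Br 3\<^esub> (rep3 (next3 i p) \<otimes>\<^bsub>Br 3\<^esub> sigma 3 i)" .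
      then show ?thesis using c by (simp add: m_assoc)
    qed
    then have v: "rep3 p \<otimes>\<^bsub>Br 3\<^esub> ?g = ?v \<otimes>\<^bsub>Br 3\<^esub> rep3 (next3 i p)"
      using step by simp
    have "rep3 p \<otimes>\<^bsub>Br 3\<^esub> class3 (l # u) = rep3 p \<otimes>\<^bsub>Br 3\<^esub> ?g \<otimes>\<^bsub>Br 3\<^esub> class3 u"
      using Cons(1,2) l i c by (subst m_assoc) (auto simp: class3_Cons simp del: in_lists_conv_set)
    also have "\<dots> = ?v \<otimes>\<^bsub>Br 3\<^esub> (rep3 (next3 i p) \<otimes>\<^bsub>Br 3\<^esub> class3 u)"
      unfolding v using c by (intro m_assoc) auto
    also have "\<dots> = ?v \<otimes>\<^bsub>Br 3\<^esub> path_value (Br 3) next3 w (next3 i p) u \<otimes>\<^bsub>Br 3\<^esub>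
        rep3 (end_state next3 (next3 i p) u)"
      unfolding Cons.IH using c by (intro m_assoc[symmetric]) auto
    finally show ?case by (simp add: l)
  qed
qed

text \<open>Schreier's argument: a pure braid starts and ends at \<open>C0\<close>, whose
  representative is 1, so \<open>rep3_class3\<close> writes it as a product of weights and their
  inverses. All weights lie in the subgroup generated by the three elements.\<close>

lemma generate_PB3: "carrier (PB 3) = generate (PB 3) {xgen 3 1 2, xgen 3 2 3, xgen 3 1 3}"
  (is "_ = generate _ ?X")
proof
  interpret group "Br 3" by (rule group_Br)
  have X: "?X \<subseteq> carrier (PB 3)" using xgen3_in_PB3 by simp
  then have X': "?X \<subseteq> carrier (Br 3)" using subgroup.subset[OF subgroup_PB] by blast
  show "generate (PB 3) ?X \<subseteq> carrier (PB 3)" by (rule group.generate_incl[OF group_PB X])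
  let ?w = "weight3 (Br 3) (xgen 3 1 2) (xgen 3 2 3) (xgen 3 1 3)"
  interpret X: subgroup "generate (Br 3) ?X" "Br 3" by (rule generate_is_subgroup[OF X'])
  have "xgen 3 1 2 \<in> generate (Br 3) ?X" "xgen 3 2 3 \<in> generate (Br 3) ?X" "xgen 3 1 3 \<in> generate (Br 3) ?X"
    by (auto intro: generate.incl)
  then have w: "?w i p \<in> generate (Br 3) ?X" for i p by (cases p) auto
  have pv: "path_value (Br 3) next3 ?w p u \<in> generate (Br 3) ?X" for p u
  proof (induction next3 p u rule: end_state.induct)
    case (2 p i b u)
    then show ?case using w by simp
  qed simp
  show "carrier (PB 3) \<subseteq> generate (PB 3) ?X"
  proof
    fix A assume A: "A \<in> carrier (PB 3)"
    then obtain u where u: "u \<in> words3" "A = class3 u"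
      using subgroup.subset[OF subgroup_PB[of 3]] by (auto simp: carrier_Br3)
    then have "end_state next3 C0 u = C0" using A in_PB3_iff by simp
    then have "A = path_value (Br 3) next3 ?w C0 u"
      using rep3_class3[OF u(1), of C0] u class3_closed[OF u(1)] pv X.mem_carrier by simp
    then show "A \<in> generate (PB 3) ?X" using pv generate_PB[OF X] by simp
  qed
qed

section \<open>Pure braids on four strands and the five homomorphisms\<close>

lemma (in group) commute_mult:
  assumes "L \<in> carrier G" "x \<in> carrier G" "y \<in> carrier G" "L \<otimes> x = x \<otimes> L" "L \<otimes> y = y \<otimes> L"
  shows "L \<otimes> (x \<otimes> y) = x \<otimes> y \<otimes> L"
proof -
  have "L \<otimes> (x \<otimes> y) = (L \<otimes> x) \<otimes> y" using assms(1-3) by (simp add: m_assoc)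
  also have "\<dots> = x \<otimes> (L \<otimes> y)" using assms(1-3) by (simp add: assms(4) m_assoc)
  also have "\<dots> = x \<otimes> y \<otimes> L" using assms(1-3) by (simp add: assms(5) m_assoc)
  finally show ?thesis .
qed

text \<open>A relation of length four, \<open>A t A t = t A t A\<close>, already implies the pure
  braid relations. The triples of all five homomorphisms except \<open>phi_1_23_4\<close> are of one
  of the two forms, with \<open>t\<close> a standard generator and \<open>A\<close> a pure
  braid.\<close>

lemma (in group) PB3_relations_conj:
  assumes c: "A \<in> carrier G" "t \<in> carrier G"
    and r: "A \<otimes> (t \<otimes> (A \<otimes> t)) = t \<otimes> (A \<otimes> (t \<otimes> A))"
  shows "PB3_relations G A (t \<otimes> t) (t \<otimes> (A \<otimes> inv t))"
    and "PB3_relations G (t \<otimes> t) A (inv t \<otimes> (A \<otimes> t))"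
proof -
  have r': "A \<otimes> (t \<otimes> (A \<otimes> (t \<otimes> z))) = t \<otimes> (A \<otimes> (t \<otimes> (A \<otimes> z)))" if "z \<in> carrier G" for z
    using arg_cong[OF r, of "\<lambda>g. g \<otimes> z"] c that by (simp add: m_assoc)
  have "t \<otimes> (t \<otimes> (A \<otimes> (t \<otimes> (A \<otimes> inv t)))) = t \<otimes> (A \<otimes> (t \<otimes> A))"
    using r'[of "inv t"] c r by simp
  then show "PB3_relations G A (t \<otimes> t) (t \<otimes> (A \<otimes> inv t))"
    using c r by (simp add: PB3_relations_def m_assoc cancel_left)
  have "inv t \<otimes> (A \<otimes> (t \<otimes> (A \<otimes> (t \<otimes> t)))) = A \<otimes> (t \<otimes> (A \<otimes> t))"
    using r'[of t] c by (simp add: cancel_left)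
  then show "PB3_relations G (t \<otimes> t) A (inv t \<otimes> (A \<otimes> t))"
    using c r by (simp add: PB3_relations_def m_assoc cancel_left)
qed

text \<open>Both sides equal the full twist \<open>(s t)^3\<close>. This is the hypothesis of
  \<open>PB3_relations_conj\<close> for \<open>A = s^2\<close>.\<close>

lemma (in group) square_braid_relation:
  assumes c: "s \<in> carrier G" "t \<in> carrier G" and r: "s \<otimes> (t \<otimes> s) = t \<otimes> (s \<otimes> t)"
  shows "(s \<otimes> s) \<otimes> (t \<otimes> ((s \<otimes> s) \<otimes> t)) = t \<otimes> ((s \<otimes> s) \<otimes> (t \<otimes> (s \<otimes> s)))"
proof -
  note r' = braid_relation_shift[OF c r]
  have "(s \<otimes> s) \<otimes> (t \<otimes> ((s \<otimes> s) \<otimes> t)) = s \<otimes> (t \<otimes> (s \<otimes> (t \<otimes> (s \<otimes> t))))"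
    using c r'[of "s \<otimes> t"] by (simp add: m_assoc)
  also have "\<dots> = t \<otimes> (s \<otimes> (t \<otimes> (t \<otimes> (s \<otimes> t))))"
    using c r'[of "t \<otimes> (s \<otimes> t)"] by simp
  also have "\<dots> = t \<otimes> (s \<otimes> (t \<otimes> (s \<otimes> (t \<otimes> s))))"
    using r by simp
  also have "\<dots> = t \<otimes> (s \<otimes> (s \<otimes> (t \<otimes> (s \<otimes> s))))"
    using c r'[of s] by simp
  finally show ?thesis using c by (simp add: m_assoc)
qed

text \<open>Two expressions for \<open>x13\<close>, obtained from
  \<open>braid_conjugate_square\<close> by cancelling \<open>s^2\<close> on the left and multiplying
  by \<open>s\<close> on the right.\<close>

lemma (in group) square_conj_swap:
  assumes c: "s \<in> carrier G" "t \<in> carrier G" and r: "s \<otimes> (t \<otimes> s) = t \<otimes> (s \<otimes> t)"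
  shows "t \<otimes> (s \<otimes> (s \<otimes> inv t)) = inv s \<otimes> (t \<otimes> (t \<otimes> s))"
proof -
  have "inv s \<otimes> (inv s \<otimes> (s \<otimes> (s \<otimes> (t \<otimes> (s \<otimes> (s \<otimes> (inv t \<otimes> inv s))))) \<otimes> s)) =
      inv s \<otimes> (inv s \<otimes> (s \<otimes> (t \<otimes> t) \<otimes> s))"
    unfolding braid_conjugate_square[OF c r] ..
  then show ?thesis using c by (simp add: m_assoc cancel_left)
qed

text \<open>The relations of \<open>Br 4\<close> are assumed for arbitrary elements, so that
  exchanging the first and the last generator gives another instance (\<open>mirror\<close>) and
  each identity also holds in mirrored form.\<close>

locale four_strands = group +
  fixes s t u
  assumes closed [simp]: "s \<in> carrier G" "t \<in> carrier G" "u \<in> carrier G"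
    and st: "s \<otimes> (t \<otimes> s) = t \<otimes> (s \<otimes> t)"
    and tu: "t \<otimes> (u \<otimes> t) = u \<otimes> (t \<otimes> u)"
    and su: "s \<otimes> u = u \<otimes> s"
begin

lemma mirror: "four_strands G u t s"
  by unfold_locales (simp_all add: st tu su)

lemma su_shift: "z \<in> carrier G \<Longrightarrow> s \<otimes> (u \<otimes> z) = u \<otimes> (s \<otimes> z)"
  using su by (simp flip: m_assoc)

text \<open>This is \<open>x14 x24 x34\<close>: the fourth strand circles the first three. It
  therefore commutes with the crossings \<open>s\<close> and \<open>t\<close> of those three
  strands, as the next lemmas verify.\<close>

abbreviation (input) strand_loop where
  "strand_loop \<equiv> u \<otimes> (t \<otimes> (s \<otimes> (s \<otimes> (t \<otimes> u))))"

lemma strand_loop_commute_s: "strand_loop \<otimes> s = s \<otimes> strand_loop"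
proof -
  note st' = braid_relation_shift[OF closed(1,2) st]
  have "s \<otimes> strand_loop = u \<otimes> (s \<otimes> (t \<otimes> (s \<otimes> (s \<otimes> (t \<otimes> u)))))"
    by (simp add: su_shift)
  also have "\<dots> = u \<otimes> (t \<otimes> (s \<otimes> (t \<otimes> (s \<otimes> (t \<otimes> u)))))"
    by (simp add: st'[of "s \<otimes> (t \<otimes> u)"])
  also have "\<dots> = u \<otimes> (t \<otimes> (s \<otimes> (s \<otimes> (t \<otimes> (s \<otimes> u)))))"
    by (simp add: st'[of u])
  also have "\<dots> = strand_loop \<otimes> s"
    by (simp add: su m_assoc)
  finally show ?thesis ..
qed

lemma strand_loop_commute_t: "strand_loop \<otimes> t = t \<otimes> strand_loop"
proof -
  note tu' = braid_relation_shift[OF closed(2,3) tu]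
  have "t \<otimes> strand_loop = u \<otimes> (t \<otimes> (u \<otimes> (s \<otimes> (s \<otimes> (t \<otimes> u)))))"
    by (simp add: tu'[of "s \<otimes> (s \<otimes> (t \<otimes> u))"])
  also have "\<dots> = u \<otimes> (t \<otimes> (s \<otimes> (s \<otimes> (u \<otimes> (t \<otimes> u)))))"
    by (simp add: su_shift)
  also have "\<dots> = u \<otimes> (t \<otimes> (s \<otimes> (s \<otimes> (t \<otimes> (u \<otimes> t)))))"
    by (simp add: tu)
  also have "\<dots> = strand_loop \<otimes> t"
    by (simp add: m_assoc)
  finally show ?thesis ..
qed

lemma strand_loop_commute:
  "strand_loop \<otimes> (t \<otimes> (s \<otimes> (s \<otimes> t))) = t \<otimes> (s \<otimes> (s \<otimes> t)) \<otimes> strand_loop"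
  "strand_loop \<otimes> (s \<otimes> (t \<otimes> (t \<otimes> s))) = s \<otimes> (t \<otimes> (t \<otimes> s)) \<otimes> strand_loop"
  by (intro commute_mult m_closed closed strand_loop_commute_s strand_loop_commute_t)+

text \<open>Here \<open>t s s t\<close> is \<open>x13 x23\<close>, and \<open>u (t s s t) u\<close>
  is \<open>strand_loop\<close>, so the relation of length four is the commutation of these
  two.\<close>

lemma cabled_braid_relation:
  "(t \<otimes> (s \<otimes> (s \<otimes> t))) \<otimes> (u \<otimes> ((t \<otimes> (s \<otimes> (s \<otimes> t))) \<otimes> u)) =
    u \<otimes> ((t \<otimes> (s \<otimes> (s \<otimes> t))) \<otimes> (u \<otimes> (t \<otimes> (s \<otimes> (s \<otimes> t)))))"
  using strand_loop_commute(1) by (simp add: m_assoc)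

abbreviation (input) x12 where "x12 \<equiv> s \<otimes> s"
abbreviation (input) x23 where "x23 \<equiv> t \<otimes> t"
abbreviation (input) x34 where "x34 \<equiv> u \<otimes> u"
abbreviation (input) x13 where "x13 \<equiv> t \<otimes> (s \<otimes> (s \<otimes> inv t))"
abbreviation (input) x24 where "x24 \<equiv> u \<otimes> (t \<otimes> (t \<otimes> inv u))"
abbreviation (input) x14 where "x14 \<equiv> u \<otimes> (t \<otimes> (s \<otimes> (s \<otimes> (inv t \<otimes> inv u))))"

text \<open>The right side is the mirror image of \<open>x13 x23 = t s s t\<close>, so that the
  mirrored \<open>cabled_braid_relation\<close> applies to it.\<close>

lemma x23_x24: "x23 \<otimes> x24 = t \<otimes> (u \<otimes> (u \<otimes> t))"
proof -
  note tu' = braid_relation_shift[OF closed(2,3) tu]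
  have "x23 \<otimes> x24 = t \<otimes> (u \<otimes> (t \<otimes> (u \<otimes> (t \<otimes> inv u))))"
    by (simp add: m_assoc tu'[of "t \<otimes> inv u"])
  also have "\<dots> = t \<otimes> (u \<otimes> (u \<otimes> (t \<otimes> (u \<otimes> inv u))))"
    by (simp only: tu'[of "inv u"] closed inv_closed)
  finally show ?thesis by simp
qed

lemma s_inv_u: "s \<otimes> inv u = inv u \<otimes> s" "u \<otimes> inv s = inv s \<otimes> u"
  by (metis closed cancel_left inv_closed m_closed inv_solve_right' m_assoc su)+

text \<open>\<open>square_conj_swap\<close> turns the conjugation by \<open>t\<close> inside
  \<open>x14\<close> into one by \<open>s\<close>, and \<open>s\<close> commutes with
  \<open>u\<close>. Since \<open>x13\<close> arises from \<open>x23\<close> by the same conjugation,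
  \<open>x13 x14\<close> arises in this way from \<open>x23 x24\<close>.\<close>

lemma x14_conj: "x14 = inv s \<otimes> (x24 \<otimes> s)"
proof -
  have "x14 = u \<otimes> (t \<otimes> (s \<otimes> (s \<otimes> inv t)) \<otimes> inv u)" by (simp add: m_assoc)
  also have "\<dots> = u \<otimes> inv s \<otimes> (t \<otimes> (t \<otimes> (s \<otimes> inv u)))"
    by (simp add: square_conj_swap[OF closed(1,2) st] m_assoc)
  also have "\<dots> = inv s \<otimes> (x24 \<otimes> s)"
    unfolding s_inv_u by (simp add: m_assoc)
  finally show ?thesis .
qed

lemma x13_x14: "x13 \<otimes> x14 = inv s \<otimes> ((x23 \<otimes> x24) \<otimes> s)"
  unfolding x14_conj square_conj_swap[OF closed(1,2) st] by (simp add: m_assoc cancel_left)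

lemma PB3_relations_123: "PB3_relations G x12 x23 x13"
  using PB3_relations_conj(1)[OF _ _ square_braid_relation[OF closed(1,2) st]] by (simp add: m_assoc)

lemma PB3_relations_234: "PB3_relations G x23 x34 x24"
  using PB3_relations_conj(1)[OF _ _ square_braid_relation[OF closed(2,3) tu]] by (simp add: m_assoc)

lemma PB3_relations_12_3_4: "PB3_relations G (x13 \<otimes> x23) x34 (x14 \<otimes> x24)"
  using PB3_relations_conj(1)[OF _ _ cabled_braid_relation] by (simp add: m_assoc cancel_left)

lemma PB3_relations_1_2_34: "PB3_relations G x12 (x23 \<otimes> x24) (x13 \<otimes> x14)"
  unfolding x13_x14 unfolding x23_x24
  using PB3_relations_conj(2)[OF _ _ four_strands.cabled_braid_relation[OF mirror]] by simp

text \<open>Write \<open>a\<close>, \<open>b\<close>, \<open>d\<close> for the three values. Then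
  \<open>a d\<close> is the loop of the first strand around the other three and commutes with
  \<open>b\<close>, while \<open>d b\<close> is \<open>strand_loop\<close> and commutes with
  \<open>a\<close>. These two commutations are the required equations.\<close>

lemma PB3_relations_1_23_4: "PB3_relations G (x12 \<otimes> x13) (x24 \<otimes> x34) x14"
proof -
  have a: "x12 \<otimes> x13 = s \<otimes> (t \<otimes> (t \<otimes> s))"
    unfolding square_conj_swap[OF closed(1,2) st] by (simp add: m_assoc cancel_left)
  have b: "x24 \<otimes> x34 = u \<otimes> (t \<otimes> (t \<otimes> u))" by (simp add: m_assoc cancel_left)
  have "s \<otimes> (t \<otimes> (t \<otimes> s)) \<otimes> x14 = s \<otimes> ((x23 \<otimes> x24) \<otimes> s)"
    unfolding x14_conj by (simp add: m_assoc cancel_left)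
  then have ad: "s \<otimes> (t \<otimes> (t \<otimes> s)) \<otimes> x14 = s \<otimes> (t \<otimes> (u \<otimes> (u \<otimes> (t \<otimes> s))))"
    unfolding x23_x24 by (simp add: m_assoc)
  have db: "x14 \<otimes> (u \<otimes> (t \<otimes> (t \<otimes> u))) = strand_loop"
    by (simp add: m_assoc cancel_left)
  let ?a = "s \<otimes> (t \<otimes> (t \<otimes> s))" and ?b = "u \<otimes> (t \<otimes> (t \<otimes> u))"
  have "?b \<otimes> (?a \<otimes> x14) = ?a \<otimes> x14 \<otimes> ?b"
    unfolding ad by (rule four_strands.strand_loop_commute(2)[OF mirror, symmetric])
  moreover have "?a \<otimes> (x14 \<otimes> ?b) = x14 \<otimes> ?b \<otimes> ?a"
    unfolding db by (rule strand_loop_commute(2)[symmetric])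
  ultimately show ?thesis
    unfolding a b PB3_relations_def by (simp add: m_assoc)
qed

end

section \<open>The five homomorphisms and the normal subgroup \<open>N_PB3 N\<close>\<close>

lemma (in group) group_prod_closed: "set gs \<subseteq> carrier G \<Longrightarrow> group_prod G gs \<in> carrier G"
  by (induction gs) (simp_all add: group_prod_def)

lemma normal_PB: "carrier (PB n) \<lhd> Br n"
  unfolding carrier_PB by (rule group_hom.normal_kernel[OF group_hom_braid_perm])

lemma xgen_in_PB:
  assumes "1 \<le> i" "i < j" "j \<le> n"
  shows "xgen n i j \<in> carrier (PB n)"
proof -
  interpret group_hom "Br n" "sym_group n" "braid_perm n" by (rule group_hom_braid_perm)
  define t where "t = group_prod (Br n) (map (sigma n) (rev [i + 1..<j]))"
  have t: "t \<in> carrier (Br n)"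
    unfolding t_def using assms by (intro G.group_prod_closed) (auto intro!: sigma_closed)
  have i: "i \<in> {1..<n}" using assms by simp
  then have "braid_perm n (sigma n i \<otimes>\<^bsub>Br n\<^esub> sigma n i) = \<one>\<^bsub>sym_group n\<^esub>"
    by (simp add: sigma_closed braid_perm_sigma sym_group_mult sym_group_one)
  then have "sigma n i \<otimes>\<^bsub>Br n\<^esub> sigma n i \<in> carrier (PB n)"
    using i by (simp add: carrier_PB kernel_def sigma_closed)
  from normal.inv_op_closed2[OF normal_PB t this] show ?thesis
    using t sigma_closed[OF i]
    by (simp add: xgen_def Let_def group_prod_def G.pow_two G.m_assoc flip: t_def[unfolded group_prod_def])
qed

lemma four_strands_Br4: "four_strands (Br 4) (sigma 4 1) (sigma 4 2) (sigma 4 3)"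
proof -
  interpret group "Br 4" by (rule group_Br)
  show ?thesis
    using sigma_braid[of 1 4] sigma_braid[of 2 4] sigma_commute[of 1 3 4]
    by unfold_locales (simp_all add: sigma_closed)
qed

lemma xgen4:
  fixes s t u
  defines "s \<equiv> sigma 4 1" and "t \<equiv> sigma 4 2" and "u \<equiv> sigma 4 3"
  shows "xgen 4 1 2 = s \<otimes>\<^bsub>Br 4\<^esub> s" "xgen 4 2 3 = t \<otimes>\<^bsub>Br 4\<^esub> t" "xgen 4 3 4 = u \<otimes>\<^bsub>Br 4\<^esub> u"
    "xgen 4 1 3 = t \<otimes>\<^bsub>Br 4\<^esub> (s \<otimes>\<^bsub>Br 4\<^esub> (s \<otimes>\<^bsub>Br 4\<^esub> inv\<^bsub>Br 4\<^esub> t))"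
    "xgen 4 2 4 = u \<otimes>\<^bsub>Br 4\<^esub> (t \<otimes>\<^bsub>Br 4\<^esub> (t \<otimes>\<^bsub>Br 4\<^esub> inv\<^bsub>Br 4\<^esub> u))"
    "xgen 4 1 4 = u \<otimes>\<^bsub>Br 4\<^esub> (t \<otimes>\<^bsub>Br 4\<^esub> (s \<otimes>\<^bsub>Br 4\<^esub> (s \<otimes>\<^bsub>Br 4\<^esub> (inv\<^bsub>Br 4\<^esub> t \<otimes>\<^bsub>Br 4\<^esub> inv\<^bsub>Br 4\<^esub> u))))"
proof -
  interpret group "Br 4" by (rule group_Br)
  have c: "s \<in> carrier (Br 4)" "t \<in> carrier (Br 4)" "u \<in> carrier (Br 4)"
    by (simp_all add: s_def t_def u_def sigma_closed)
  show "xgen 4 1 2 = s \<otimes>\<^bsub>Br 4\<^esub> s" "xgen 4 2 3 = t \<otimes>\<^bsub>Br 4\<^esub> t" "xgen 4 3 4 = u \<otimes>\<^bsub>Br 4\<^esub> u"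
    using xgen_adjacent[of 1 4] xgen_adjacent[of 2 4] xgen_adjacent[of 3 4]
    by (simp_all add: s_def t_def u_def)
  have "[1 + 1..<3] = [2::nat]" "[2 + 1..<4] = [3::nat]" "[1 + 1..<4] = [2::nat, 3]"
    by (simp_all add: upt_rec)
  then show "xgen 4 1 3 = t \<otimes>\<^bsub>Br 4\<^esub> (s \<otimes>\<^bsub>Br 4\<^esub> (s \<otimes>\<^bsub>Br 4\<^esub> inv\<^bsub>Br 4\<^esub> t))"
    "xgen 4 2 4 = u \<otimes>\<^bsub>Br 4\<^esub> (t \<otimes>\<^bsub>Br 4\<^esub> (t \<otimes>\<^bsub>Br 4\<^esub> inv\<^bsub>Br 4\<^esub> u))"
    "xgen 4 1 4 = u \<otimes>\<^bsub>Br 4\<^esub> (t \<otimes>\<^bsub>Br 4\<^esub> (s \<otimes>\<^bsub>Br 4\<^esub> (s \<otimes>\<^bsub>Br 4\<^esub> (inv\<^bsub>Br 4\<^esub> t \<otimes>\<^bsub>Br 4\<^esub> inv\<^bsub>Br 4\<^esub> u))))"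
    using c by (simp_all add: xgen_def group_prod_def pow_two m_assoc Let_def inv_mult_group
        flip: s_def t_def u_def)
qed

lemma phi_hom_in_hom:
  assumes "PB3_relations (Br 4) a b d" "a \<in> carrier (PB 4)" "b \<in> carrier (PB 4)" "d \<in> carrier (PB 4)"
  shows "phi_hom a b d \<in> hom (PB 3) (PB 4)"
proof -
  have "PB3_relations (PB 4) a b d" using assms by (simp add: PB3_relations_def)
  from PB3_hom_exists[OF group_PB this] obtain h where h: "h \<in> hom (PB 3) (PB 4)"
    "h (xgen 3 1 2) = a" "h (xgen 3 2 3) = b" "h (xgen 3 1 3) = d" .
  have "phi_hom a b d = restrict h (carrier (PB 3))"
    unfolding phi_hom_def
    by (rule hom_with_values_eq[OF group_PB group_PB h(1)]) (use generate_PB3 h in auto)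
  then show ?thesis
    using h(1) group.is_monoid[OF group_PB] by (auto simp: hom_def monoid.m_closed simp del: mult_PB)
qed

lemma phi_homs:
  "{phi_123, phi_234, phi_12_3_4, phi_1_23_4, phi_1_2_34} \<subseteq> hom (PB 3) (PB 4)"
proof -
  interpret four_strands "Br 4" "sigma 4 1" "sigma 4 2" "sigma 4 3" by (rule four_strands_Br4)
  have c: "xgen 4 i j \<in> carrier (PB 4)" if "1 \<le> i" "i < j" "j \<le> 4" for i j
    using that by (rule xgen_in_PB)
  have m: "g \<otimes>\<^bsub>Br 4\<^esub> h \<in> carrier (PB 4)" if "g \<in> carrier (PB 4)" "h \<in> carrier (PB 4)" for g h
    using that by (rule subgroup.m_closed[OF subgroup_PB])
  note r = PB3_relations_123 PB3_relations_234 PB3_relations_12_3_4 PB3_relations_1_23_4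
    PB3_relations_1_2_34
  show ?thesis
    unfolding phi_123_def phi_234_def phi_12_3_4_def phi_1_23_4_def phi_1_2_34_def
    using r[folded xgen4] by (auto intro!: phi_hom_in_hom m c)
qed

lemma normal_vimage_homs:
  assumes "group G" "group H" "\<Phi> \<subseteq> hom G H" "N \<lhd> H"
  shows "{g \<in> carrier G. \<forall>\<phi>\<in>\<Phi>. \<phi> g \<in> N} \<lhd> G"
proof -
  interpret G: group G by fact
  interpret N: normal N H by fact
  have hom: "group_hom G H \<phi>" if "\<phi> \<in> \<Phi>" for \<phi>
    using that assms by (auto simp: group_hom_def group_hom_axioms_def)
  show ?thesis
  proof (rule G.normal_invI)
    show "subgroup {g \<in> carrier G. \<forall>\<phi>\<in>\<Phi>. \<phi> g \<in> N} G"
      by (rule G.subgroupI)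
        (auto simp: group_hom.hom_mult[OF hom] group_hom.hom_inv[OF hom] group_hom.hom_one[OF hom] intro!: exI[of _ "\<one>\<^bsub>G\<^esub>"])
    fix g h assume "g \<in> carrier G" "h \<in> {g \<in> carrier G. \<forall>\<phi>\<in>\<Phi>. \<phi> g \<in> N}"
    then show "g \<otimes>\<^bsub>G\<^esub> h \<otimes>\<^bsub>G\<^esub> inv\<^bsub>G\<^esub> g \<in> {g \<in> carrier G. \<forall>\<phi>\<in>\<Phi>. \<phi> g \<in> N}"
      by (auto simp: group_hom.hom_mult[OF hom] group_hom.hom_inv[OF hom] group_hom.hom_closed[OF hom]
          N.inv_op_closed2)
  qed
qed

lemma normal_N_PB3:
  assumes "N \<in> NFI_PB4"
  shows "N_PB3 N \<lhd> PB 3"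
proof -
  have "N \<lhd> Br 4" "N \<subseteq> carrier (PB 4)" using assms by (auto simp: NFI_PB4_def)
  then have "N \<lhd> PB 4"
    using group.normal_restrict_supergroup[OF group_Br subgroup_PB] by (simp add: PB_def)
  from normal_vimage_homs[OF group_PB group_PB phi_homs this] show ?thesis
    by (simp add: N_PB3_def)
qed

declare mult_PB [simp del] one_PB [simp del]

section \<open>The free group and the center\<close>

abbreviation gx :: braid where "gx \<equiv> xgen 3 1 2"
abbreviation gy :: braid where "gy \<equiv> xgen 3 2 3"

lemma PB3_relations_xgen: "PB3_relations (PB 3) gx gy (xgen 3 1 3)"
proof -
  interpret group "Br 3" by (rule group_Br)
  have c: "sigma 3 1 \<in> carrier (Br 3)" "sigma 3 2 \<in> carrier (Br 3)" by (simp_all add: sigma_closed)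
  have "sigma 3 1 \<otimes>\<^bsub>Br 3\<^esub> (sigma 3 2 \<otimes>\<^bsub>Br 3\<^esub> sigma 3 1) =
      sigma 3 2 \<otimes>\<^bsub>Br 3\<^esub> (sigma 3 1 \<otimes>\<^bsub>Br 3\<^esub> sigma 3 2)"
    using sigma_braid[of 1 3] by simp
  from PB3_relations_conj(1)[OF _ _ square_braid_relation[OF c this]]
  have "PB3_relations (Br 3) gx gy (xgen 3 1 3)"
    using c by (simp add: xgen3_12 xgen3_23 xgen3_13 m_assoc)
  then show ?thesis using xgen3_in_PB3 by (simp add: PB3_relations_def mult_PB)
qed

text \<open>The words \<open>b a d\<close>, \<open>a d b\<close> and \<open>d b a\<close> have the
  same value, and a generator can be moved from the end of one to the front of another: for instance
  \<open>(a d b) a = a (d b a)\<close>.\<close>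

lemma (in group) PB3_relations_central:
  assumes r: "PB3_relations G a b d" and g: "g \<in> {a, b, d}"
  shows "b \<otimes> (a \<otimes> d) \<otimes> g = g \<otimes> (b \<otimes> (a \<otimes> d))"
proof -
  have c: "a \<in> carrier G" "b \<in> carrier G" "d \<in> carrier G"
    and bad: "b \<otimes> (a \<otimes> d) = a \<otimes> (d \<otimes> b)" and adb: "a \<otimes> (d \<otimes> b) = d \<otimes> (b \<otimes> a)"
    using r by (simp_all add: PB3_relations_def)
  have "a \<otimes> (d \<otimes> b) \<otimes> a = a \<otimes> (d \<otimes> (b \<otimes> a))" "b \<otimes> (a \<otimes> d) \<otimes> b = b \<otimes> (a \<otimes> (d \<otimes> b))"
    "d \<otimes> (b \<otimes> a) \<otimes> d = d \<otimes> (b \<otimes> (a \<otimes> d))"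
    using c by (simp_all add: m_assoc)
  then show ?thesis using g bad adb by auto
qed

lemma c3_eq: "c3 = gy \<otimes>\<^bsub>PB 3\<^esub> (gx \<otimes>\<^bsub>PB 3\<^esub> xgen 3 1 3)"
proof -
  have "xgen 3 1 3 \<in> carrier (Br 3)" using xgen3_in_PB3(3) subgroup.subset[OF subgroup_PB] by blast
  then show ?thesis
    using monoid.r_one[OF group.is_monoid[OF group_Br]] by (simp add: c3_def group_prod_def mult_PB)
qed

lemma c3_closed: "c3 \<in> carrier (PB 3)"
  unfolding c3_eq using xgen3_in_PB3 monoid.m_closed[OF group.is_monoid[OF group_PB]] by blast

lemma (in group) commute_inv:
  assumes "g \<in> carrier G" "h \<in> carrier G" "h \<otimes> g = g \<otimes> h"
  shows "h \<otimes> inv g = inv g \<otimes> h"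
proof -
  have "inv g \<otimes> (h \<otimes> g) \<otimes> inv g = inv g \<otimes> (g \<otimes> h) \<otimes> inv g" using assms(3) by simp
  then show ?thesis using assms(1,2) by (simp add: m_assoc cancel_left)
qed

lemma (in group) commute_int_pow:
  assumes "g \<in> carrier G" "h \<in> carrier G" "h \<otimes> g = g \<otimes> h"
  shows "h \<otimes> g [^] (k :: int) = g [^] k \<otimes> h"
  using assms group_commutes_pow[of g h] commute_inv
  by (cases k rule: int_cases2) (simp_all add: int_pow_int int_pow_neg)

lemma c3_central:
  assumes "g \<in> carrier (PB 3)"
  shows "c3 \<otimes>\<^bsub>PB 3\<^esub> g = g \<otimes>\<^bsub>PB 3\<^esub> c3"
proof -
  interpret group "PB 3" by (rule group_PB)
  note c = xgen3_in_PB3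
  have gens: "c3 \<otimes>\<^bsub>PB 3\<^esub> g = g \<otimes>\<^bsub>PB 3\<^esub> c3" if "g \<in> {gx, gy, xgen 3 1 3}" for g
    unfolding c3_eq by (rule PB3_relations_central[OF PB3_relations_xgen that])
  have "g \<in> generate (PB 3) {gx, gy, xgen 3 1 3}" using assms generate_PB3 by simp
  then show ?thesis
  proof induction
    case one
    then show ?case using c3_closed by simp
  next
    case (incl g)
    then show ?case by (rule gens)
  next
    case (inv g)
    then have g: "g \<in> carrier (PB 3)" using c by blast
    show ?case using commute_inv[OF g c3_closed gens[OF inv]] .
  next
    case (eng g h)
    then show ?case using c3_closed generate_PB3 commute_mult by simp
  qed
qed

section \<open>The free subgroup on \<open>gx\<close> and \<open>gy\<close>\<close>

lemma group_F2: "group F2"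
  by (simp add: F2_def group.group_subgroup_generated group_PB)

lemma mult_F2: "monoid.mult F2 = monoid.mult (PB 3)"
  and one_F2: "one F2 = one (PB 3)"
  by (simp_all add: F2_def)

lemma inv_F2: "g \<in> carrier F2 \<Longrightarrow> inv\<^bsub>F2\<^esub> g = inv\<^bsub>PB 3\<^esub> g"
  unfolding F2_def by (rule group.inv_subgroup_generated[OF group_PB])

lemma int_pow_F2: "g \<in> carrier F2 \<Longrightarrow> g [^]\<^bsub>F2\<^esub> (k :: int) = g [^]\<^bsub>PB 3\<^esub> k"
  unfolding F2_def by (rule group.int_pow_subgroup_generated[OF group_PB])

lemma carrier_F2: "carrier F2 = generate (PB 3) {gx, gy}"
  unfolding F2_def carrier_subgroup_generated using xgen3_in_PB3 by (simp add: Int_absorb1)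

lemma subgroup_F2: "subgroup (carrier F2) (PB 3)"
  unfolding carrier_F2 using xgen3_in_PB3 by (intro group.generate_is_subgroup group_PB) simp

lemma F2_subset_PB3: "g \<in> carrier F2 \<Longrightarrow> g \<in> carrier (PB 3)"
  using subgroup.mem_carrier[OF subgroup_F2] .

lemma gens_in_F2: "gx \<in> carrier F2" "gy \<in> carrier F2"
  unfolding carrier_F2 by (auto intro: generate.incl)

lemma generate_F2: "carrier F2 = generate F2 {gx, gy}"
proof -
  have "generate F2 {gx, gy} = generate (PB 3) {gx, gy}"
    using group.generate_consistent[OF group_PB _ subgroup_F2, of "{gx, gy}"] gens_in_F2 xgen3_in_PB3
    by (simp add: F2_def subgroup_generated_def Int_absorb1)
  then show ?thesis by (simp add: carrier_F2)
qed

lemma hom_PB3_F2: "h \<in> hom (PB 3) H \<Longrightarrow> h \<in> hom F2 H"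
  unfolding F2_def by (rule group.hom_from_subgroup_generated[OF group_PB])

text \<open>Sending \<open>c\<close> to \<open>1\<close> satisfies \<open>PB3_relations\<close> for any values of \<open>x\<close> and \<open>y\<close>.\<close>

lemma F2_hom_exists:
  assumes "group H" "a \<in> carrier H" "b \<in> carrier H"
  obtains h where "h \<in> hom F2 H" "h gx = a" "h gy = b"
proof -
  interpret group H by fact
  have "PB3_relations H a b (inv\<^bsub>H\<^esub> (b \<otimes>\<^bsub>H\<^esub> a))"
    using assms by (simp add: PB3_relations_def inv_mult_group m_assoc cancel_left)
  then show thesis using PB3_hom_exists[OF assms(1)] that hom_PB3_F2 by metis
qed

lemma hom_with_values_F2_eq:
  assumes "group H" "h \<in> hom F2 H"
  shows "hom_with_values F2 H [(gx, h gx), (gy, h gy)] = restrict h (carrier F2)"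
  by (rule hom_with_values_eq[OF group_F2 assms]) (use generate_F2 in auto)

lemma hom_F2_eqI:
  assumes "group H" "h \<in> hom F2 H" "k \<in> hom F2 H" "h gx = k gx" "h gy = k gy" "g \<in> carrier F2"
  shows "h g = k g"
  using hom_eq_on_generate[OF group_F2 assms(1-3), of "{gx, gy}" g] assms(4-6) gens_in_F2 generate_F2
  by auto

text \<open>Because \<open>c3\<close> is central, the products of an element of \<open>F2\<close>
  with a power of \<open>c3\<close> form a subgroup. It contains the three generators of
  \<open>PB 3\<close>.\<close>

lemma PB3_eq_F2_c3:
  assumes "p \<in> carrier (PB 3)"
  obtains g k where "g \<in> carrier F2" "p = g \<otimes>\<^bsub>PB 3\<^esub> c3 [^]\<^bsub>PB 3\<^esub> (k :: int)"
proof -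
  interpret group "PB 3" by (rule group_PB)
  interpret F: subgroup "carrier F2" "PB 3" by (rule subgroup_F2)
  define S where "S = {g \<otimes>\<^bsub>PB 3\<^esub> c3 [^]\<^bsub>PB 3\<^esub> k | g (k :: int). g \<in> carrier F2}"
  have S: "g \<otimes>\<^bsub>PB 3\<^esub> c3 [^]\<^bsub>PB 3\<^esub> k \<in> S" if "g \<in> carrier F2" for g and k :: int
    using that unfolding S_def by blast
  let ?X = "{gx, gy, xgen 3 1 3}"
  have pow_central: "c3 [^]\<^bsub>PB 3\<^esub> k \<otimes>\<^bsub>PB 3\<^esub> g = g \<otimes>\<^bsub>PB 3\<^esub> c3 [^]\<^bsub>PB 3\<^esub> k"
    if "g \<in> carrier (PB 3)" for g and k :: int
    using commute_int_pow[of c3 g k] that c3_closed c3_central by simp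
  have "subgroup S (PB 3)"
  proof (rule subgroupI)
    show "S \<subseteq> carrier (PB 3)" unfolding S_def using c3_closed F2_subset_PB3 by auto
    show "S \<noteq> {}" using S[OF F.one_closed] by blast
  next
    fix p assume "p \<in> S"
    then obtain g and k :: int where g: "g \<in> carrier F2" "p = g \<otimes>\<^bsub>PB 3\<^esub> c3 [^]\<^bsub>PB 3\<^esub> k" unfolding S_def by blast
    then have "inv\<^bsub>PB 3\<^esub> p = inv\<^bsub>PB 3\<^esub> g \<otimes>\<^bsub>PB 3\<^esub> c3 [^]\<^bsub>PB 3\<^esub> (- k)"
      using c3_closed F2_subset_PB3
      by (simp add: inv_mult_group pow_central[of "inv\<^bsub>PB 3\<^esub> g"] flip: int_pow_neg)
    then show "inv\<^bsub>PB 3\<^esub> p \<in> S" using g S by simp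
    fix p' assume "p' \<in> S"
    then obtain h and l :: int where h: "h \<in> carrier F2" "p' = h \<otimes>\<^bsub>PB 3\<^esub> c3 [^]\<^bsub>PB 3\<^esub> l" unfolding S_def by blast
    have "p \<otimes>\<^bsub>PB 3\<^esub> p' = g \<otimes>\<^bsub>PB 3\<^esub> (c3 [^]\<^bsub>PB 3\<^esub> k \<otimes>\<^bsub>PB 3\<^esub> h) \<otimes>\<^bsub>PB 3\<^esub> c3 [^]\<^bsub>PB 3\<^esub> l"
      using g h c3_closed F2_subset_PB3 by (simp add: m_assoc)
    also have "\<dots> = g \<otimes>\<^bsub>PB 3\<^esub> h \<otimes>\<^bsub>PB 3\<^esub> c3 [^]\<^bsub>PB 3\<^esub> (k + l)"
      using g h c3_closed F2_subset_PB3 by (simp add: pow_central[of h] m_assoc int_pow_mult)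
    finally show "p \<otimes>\<^bsub>PB 3\<^esub> p' \<in> S" using g h S by simp
  qed
  moreover have "?X \<subseteq> S"
  proof -
    \<comment> \<open>From \<open>c3 = y x x13\<close> the third generator is
      \<open>(y x)^-1 c3\<close>, with exponent 1.\<close>
    have "inv\<^bsub>PB 3\<^esub> (gy \<otimes>\<^bsub>PB 3\<^esub> gx) \<in> carrier F2" using gens_in_F2 by simp
    from S[OF this, of 1] have "xgen 3 1 3 \<in> S"
      using xgen3_in_PB3 by (simp add: c3_eq inv_mult_group m_assoc cancel_left)
    moreover have "gx \<in> S" "gy \<in> S"
      using S[OF gens_in_F2(1), of 0] S[OF gens_in_F2(2), of 0] xgen3_in_PB3 by simp_all
    ultimately show ?thesis by blast
  qed
  ultimately have "generate (PB 3) ?X \<subseteq> S" using generate_subgroup_incl by blast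
  then show thesis using assms generate_PB3 that unfolding S_def by blast
qed

section \<open>The twisted homomorphism\<close>

text \<open>The endomorphism \<theta> of the overview. It does not involve \<psi>, and it is
  attached to the representatives \<open>m\<close> and \<open>f\<close> rather than to the
  GT-shadow.\<close>

definition twist :: "int \<Rightarrow> braid \<Rightarrow> braid \<Rightarrow> braid" where
  "twist m f = hom_with_values F2 F2
    [(gx, gx [^]\<^bsub>F2\<^esub> (2 * m + 1)), (gy, group_prod F2 [inv\<^bsub>F2\<^esub> f, gy [^]\<^bsub>F2\<^esub> (2 * m + 1), f])]"

lemma twist:
  assumes "f \<in> carrier F2"
  shows "twist m f \<in> hom F2 F2"
    and "twist m f gx = gx [^]\<^bsub>F2\<^esub> (2 * m + 1)"
    and "twist m f gy = group_prod F2 [inv\<^bsub>F2\<^esub> f, gy [^]\<^bsub>F2\<^esub> (2 * m + 1), f]"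
proof -
  interpret group F2 by (rule group_F2)
  have "gx [^]\<^bsub>F2\<^esub> (2 * m + 1) \<in> carrier F2"
    "group_prod F2 [inv\<^bsub>F2\<^esub> f, gy [^]\<^bsub>F2\<^esub> (2 * m + 1), f] \<in> carrier F2"
    using gens_in_F2 assms by (auto intro!: group_prod_closed)
  from F2_hom_exists[OF group_F2 this] obtain h where h: "h \<in> hom F2 F2"
    "h gx = gx [^]\<^bsub>F2\<^esub> (2 * m + 1)"
    "h gy = group_prod F2 [inv\<^bsub>F2\<^esub> f, gy [^]\<^bsub>F2\<^esub> (2 * m + 1), f]" .
  have eq: "twist m f = restrict h (carrier F2)"
    using hom_with_values_F2_eq[OF group_F2 h(1)] by (simp only: twist_def h)
  show "twist m f \<in> hom F2 F2" using h(1) by (auto simp: eq hom_def)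
  show "twist m f gx = gx [^]\<^bsub>F2\<^esub> (2 * m + 1)"
    "twist m f gy = group_prod F2 [inv\<^bsub>F2\<^esub> f, gy [^]\<^bsub>F2\<^esub> (2 * m + 1), f]"
    using gens_in_F2 by (simp_all only: eq h restrict_apply' )
qed

lemma twisted_hom_eq:
  assumes "f \<in> carrier F2" "\<psi> \<in> hom F2 (sym_group d)"
  shows "twisted_hom d \<psi> m f = (\<lambda>g\<in>carrier F2. \<psi> (twist m f g))"
proof -
  have "\<psi> \<circ> twist m f \<in> hom F2 (sym_group d)"
    using hom_compose[OF twist(1)[OF assms(1)] assms(2)] .
  from hom_with_values_F2_eq[OF sym_group_is_group this] show ?thesis
    using assms(1) by (simp only: twisted_hom_def Let_def twist o_def)
qed

text \<open>\<open>K\<close> stands for \<open>N_PB3 N\<close> and \<open>H\<close> for the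
  symmetric group. Although \<psi> is a homomorphism on \<open>F2\<close> only, \<open>ker\<close>
  allows computing modulo \<open>K\<close> in \<open>PB 3\<close>: elements of \<open>F2\<close> in
  the same coset of \<open>K\<close> have the same image.\<close>

locale subordinate_hom = group_hom F2 H \<psi> + K: normal K "PB 3" for H (structure) and \<psi> and K +
  assumes ker: "K \<inter> carrier F2 \<subseteq> kernel F2 H \<psi>"
begin

abbreviation coset :: "braid \<Rightarrow> braid set" where
  "coset g \<equiv> K #>\<^bsub>PB 3\<^esub> g"

sublocale Q: group_hom "PB 3" "PB 3 Mod K" coset
  by (simp add: group_hom_def group_hom_axioms_def group_PB K.factorgroup_is_group K.r_coset_hom_Mod)

lemma coset_F2_hom: "coset \<in> hom F2 (PB 3 Mod K)"
  by (rule hom_PB3_F2) (rule K.r_coset_hom_Mod)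

lemma psi_eq:
  assumes "g \<in> carrier F2" "h \<in> carrier F2" "coset g = coset h"
  shows "\<psi> g = \<psi> h"
proof -
  have c: "g \<in> carrier (PB 3)" "h \<in> carrier (PB 3)" using assms F2_subset_PB3 by simp_all
  have "coset (g \<otimes>\<^bsub>PB 3\<^esub> inv\<^bsub>PB 3\<^esub> h) = K"
    using c assms(3) Q.H.r_inv[of "coset h"] by (simp del: mult_FactGroup)
  then have "g \<otimes>\<^bsub>PB 3\<^esub> inv\<^bsub>PB 3\<^esub> h \<in> K"
    using c K.coset_join1[OF _ _ K.subgroup_axioms] by simp
  moreover have "g \<otimes>\<^bsub>PB 3\<^esub> inv\<^bsub>PB 3\<^esub> h = g \<otimes>\<^bsub>F2\<^esub> inv\<^bsub>F2\<^esub> h"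
    using assms by (simp add: mult_F2 inv_F2)
  ultimately have "g \<otimes>\<^bsub>F2\<^esub> inv\<^bsub>F2\<^esub> h \<in> kernel F2 H \<psi>"
    using ker assms(1,2) by auto
  then have "\<psi> g \<otimes> inv (\<psi> h) = \<one>" using assms(1,2) by (simp add: kernel_def)
  then show ?thesis using assms(1,2) H.inv_solve_right'[of "\<one>" "\<psi> g" "\<psi> h"] by simp
qed

lemma psi_int_pow_eq:
  assumes "g \<in> carrier F2" "int (group.ord (PB 3 Mod K) (coset g)) dvd l - k"
  shows "\<psi> (g [^]\<^bsub>F2\<^esub> k) = \<psi> (g [^]\<^bsub>F2\<^esub> l)"
proof (rule psi_eq)
  have "g \<in> carrier (PB 3)" using assms(1) F2_subset_PB3 by simp
  then show "coset (g [^]\<^bsub>F2\<^esub> k) = coset (g [^]\<^bsub>F2\<^esub> l)"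
    using assms Q.H.int_pow_eq[of "coset g" k l] by (simp add: int_pow_F2 Q.hom_int_pow)
qed (use assms in simp_all)

lemma twist_hom: "f \<in> carrier F2 \<Longrightarrow> group_hom F2 H (\<psi> \<circ> twist m f)"
  using Group.hom_compose[OF twist(1) homh]
  by (simp add: group_hom_def group_hom_axioms_def group_F2 H.group_axioms)

lemma psi_twist_y:
  assumes "f \<in> carrier F2"
  shows "\<psi> (twist m f gy) = inv (\<psi> f) \<otimes> (\<psi> (gy [^]\<^bsub>F2\<^esub> (2 * m + 1)) \<otimes> \<psi> f)"
  using assms gens_in_F2 by (simp add: twist group_prod_def)

text \<open>This gives independence of the representatives of a GT-shadow. It suffices to compare
  the values at \<open>gx\<close> and \<open>gy\<close>, where the exponent matters only modulo the
  orders in the quotient and \<open>f\<close> only through its coset.\<close>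

lemma psi_twist_cong:
  assumes f: "f \<in> carrier F2" "f' \<in> carrier F2" "coset f = coset f'"
    and ord: "int (group.ord (PB 3 Mod K) (coset gx)) dvd m' - m"
      "int (group.ord (PB 3 Mod K) (coset gy)) dvd m' - m"
    and g: "g \<in> carrier F2"
  shows "\<psi> (twist m f g) = \<psi> (twist m' f' g)"
proof -
  have d: "(2 * m' + 1) - (2 * m + 1) = 2 * (m' - m)" by simp
  have "int (group.ord (PB 3 Mod K) (coset gx)) dvd (2 * m' + 1) - (2 * m + 1)"
    "int (group.ord (PB 3 Mod K) (coset gy)) dvd (2 * m' + 1) - (2 * m + 1)"
    unfolding d by (intro dvd_mult ord)+
  then have "\<psi> (gx [^]\<^bsub>F2\<^esub> (2 * m + 1)) = \<psi> (gx [^]\<^bsub>F2\<^esub> (2 * m' + 1))"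
    "\<psi> (gy [^]\<^bsub>F2\<^esub> (2 * m + 1)) = \<psi> (gy [^]\<^bsub>F2\<^esub> (2 * m' + 1))"
    using gens_in_F2 by (blast intro: psi_int_pow_eq)+
  moreover have "\<psi> f = \<psi> f'" using psi_eq f by blast
  ultimately have "(\<psi> \<circ> twist m f) gx = (\<psi> \<circ> twist m' f') gx"
    "(\<psi> \<circ> twist m f) gy = (\<psi> \<circ> twist m' f') gy"
    using f by (simp_all add: twist(2) psi_twist_y)
  from hom_F2_eqI[OF H.group_axioms Group.hom_compose[OF twist(1)[OF f(1)] homh]
      Group.hom_compose[OF twist(1)[OF f(2)] homh] this g]
  show ?thesis by simp
qed

text \<open>
  Surjectivity gives \<open>f = \<theta>(g) c\<^sup>l\<close> modulo \<open>K\<close> for the twisting endomorphism \<open>\<theta>\<close>, so \<open>\<psi>(f)\<close> agrees with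
  \<open>\<psi>(\<theta>(g))\<close> up to an element commuting with the image of \<open>\<psi>\<close>. Conjugating by \<open>f\<close> therefore
  stays inside the twisted image.
\<close>

lemma twisted_image:
  assumes f: "f \<in> carrier F2"
    and ord: "group.ord (PB 3 Mod K) (coset gx) dvd n" "group.ord (PB 3 Mod K) (coset gy) dvd n"
    and unit: "[(2 * m + 1) * k = 1] (mod int n)"
    and T: "T \<in> hom (PB 3) (PB 3 Mod K)"
      "T gx = coset (gx [^]\<^bsub>PB 3\<^esub> (2 * m + 1))"
      "T gy = coset (group_prod (PB 3) [inv\<^bsub>PB 3\<^esub> f, gy [^]\<^bsub>PB 3\<^esub> (2 * m + 1), f])"
      "T c3 = coset (c3 [^]\<^bsub>PB 3\<^esub> (2 * m + 1))"
      "T ` carrier (PB 3) = carrier (PB 3 Mod K)"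
  shows "(\<psi> \<circ> twist m f) ` carrier F2 = \<psi> ` carrier F2"
proof
  let ?q = "2 * m + 1" and ?\<theta> = "twist m f"
  interpret th: group_hom F2 F2 ?\<theta>
    using twist(1)[OF f] by (simp add: group_hom_def group_hom_axioms_def group_F2)
  interpret h: group_hom F2 H "\<psi> \<circ> ?\<theta>" by (rule twist_hom[OF f])
  interpret T: group_hom "PB 3" "PB 3 Mod K" T
    using T(1) by (simp add: group_hom_def group_hom_axioms_def group_PB Q.H.group_axioms)
  show "(\<psi> \<circ> ?\<theta>) ` carrier F2 \<subseteq> \<psi> ` carrier F2" by auto
  let ?A = "(\<psi> \<circ> ?\<theta>) ` carrier F2"
  interpret A: subgroup ?A H by (rule h.img_is_subgroup)
  have T_F2: "T g = coset (?\<theta> g)" if "g \<in> carrier F2" for g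
  proof -
    have "(coset \<circ> ?\<theta>) gx = T gx" "(coset \<circ> ?\<theta>) gy = T gy"
      using f gens_in_F2
      by (simp_all add: twist T(2,3) group_prod_def mult_F2 one_F2 inv_F2 int_pow_F2 del: Q.hom_mult)
    from hom_F2_eqI[OF Q.H.group_axioms Group.hom_compose[OF twist(1)[OF f] coset_F2_hom]
        hom_PB3_F2[OF T(1)] this that]
    show ?thesis by simp
  qed
  have f3: "f \<in> carrier (PB 3)" using f by (rule F2_subset_PB3)
  have "coset f \<in> T ` carrier (PB 3)" using f3 unfolding T(5) by simp
  then obtain p where p: "p \<in> carrier (PB 3)" "coset f = T p" by blast
  then obtain g and j :: int where g: "g \<in> carrier F2" "p = g \<otimes>\<^bsub>PB 3\<^esub> c3 [^]\<^bsub>PB 3\<^esub> j"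
    using PB3_eq_F2_c3 by blast
  define r z where "r = ?\<theta> g" and "z = c3 [^]\<^bsub>PB 3\<^esub> (?q * j)"
  have r: "r \<in> carrier F2" "r \<in> carrier (PB 3)" using g by (simp_all add: r_def F2_subset_PB3)
  have z: "z \<in> carrier (PB 3)" using c3_closed by (simp add: z_def)
  have "T (c3 [^]\<^bsub>PB 3\<^esub> j) = coset z"
    using c3_closed by (simp add: z_def T.hom_int_pow T(4) Q.hom_int_pow Q.H.int_pow_pow)
  then have fz: "coset f = coset (r \<otimes>\<^bsub>PB 3\<^esub> z)"
    using p g c3_closed r z F2_subset_PB3 T_F2 by (simp add: r_def del: mult_FactGroup)
  \<comment> \<open>The central element \<open>z\<close> need not lie in \<open>F2\<close>, so
    \<psi> is of no use on it; \<open>v\<close> is an element of \<open>F2\<close> in the same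
    coset.\<close>
  define v where "v = inv\<^bsub>F2\<^esub> r \<otimes>\<^bsub>F2\<^esub> f"
  have v: "v \<in> carrier F2" "v \<in> carrier (PB 3)" using r f by (simp_all add: v_def F2_subset_PB3)
  have v_eq: "v = inv\<^bsub>PB 3\<^esub> r \<otimes>\<^bsub>PB 3\<^esub> f" using r by (simp add: v_def inv_F2 mult_F2)
  have "coset v = coset (inv\<^bsub>PB 3\<^esub> r) \<otimes>\<^bsub>PB 3 Mod K\<^esub> coset (r \<otimes>\<^bsub>PB 3\<^esub> z)"
    unfolding v_eq fz[symmetric] using r f3 by (intro Q.hom_mult) simp_all
  also have "\<dots> = coset (inv\<^bsub>PB 3\<^esub> r \<otimes>\<^bsub>PB 3\<^esub> (r \<otimes>\<^bsub>PB 3\<^esub> z))"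
    using r z by (intro Q.hom_mult[symmetric]) simp_all
  finally have vz: "coset v = coset z" using r z by (simp add: K.cancel_left del: Q.hom_mult)
  have central: "\<psi> v \<otimes> \<psi> u = \<psi> u \<otimes> \<psi> v" if u: "u \<in> carrier F2" for u
  proof -
    have u3: "u \<in> carrier (PB 3)" using u by (rule F2_subset_PB3)
    have "u \<otimes>\<^bsub>PB 3\<^esub> z = z \<otimes>\<^bsub>PB 3\<^esub> u"
      unfolding z_def using u3 c3_closed c3_central by (intro K.commute_int_pow) simp_all
    then have "coset z \<otimes>\<^bsub>PB 3 Mod K\<^esub> coset u = coset u \<otimes>\<^bsub>PB 3 Mod K\<^esub> coset z"
      using u3 z by (simp del: mult_FactGroup flip: Q.hom_mult)
    then have "coset (v \<otimes>\<^bsub>PB 3\<^esub> u) = coset (u \<otimes>\<^bsub>PB 3\<^esub> v)"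
      using u3 v by (simp add: vz del: mult_FactGroup)
    then have "\<psi> (v \<otimes>\<^bsub>F2\<^esub> u) = \<psi> (u \<otimes>\<^bsub>F2\<^esub> v)"
      using u v(1) by (intro psi_eq) (simp_all flip: mult_F2)
    then show ?thesis using u v(1) by simp
  qed
  have "f = r \<otimes>\<^bsub>F2\<^esub> v" using r f by (simp add: v_def G.cancel_left)
  then have psi_f: "\<psi> f = \<psi> r \<otimes> \<psi> v" using r v by simp
  have inA: "\<psi> (?\<theta> g) \<in> ?A" if "g \<in> carrier F2" for g using that by auto
  have pow: "\<psi> g \<in> ?A"
    if g: "g \<in> carrier F2" and A: "\<psi> (g [^]\<^bsub>F2\<^esub> ?q) \<in> ?A" and o: "group.ord (PB 3 Mod K) (coset g) dvd n" for g
  proof -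
    \<comment> \<open>Modulo \<open>K\<close>, \<open>g\<close> is the \<open>k\<close>-th power of
      \<open>g^q\<close>, so it is enough that the image of \<open>g^q\<close> lies in the
      subgroup.\<close>
    have "int n dvd 1 - ?q * k" using unit by (simp add: cong_iff_dvd_diff dvd_diff_commute)
    then have "int (group.ord (PB 3 Mod K) (coset g)) dvd 1 - ?q * k"
      using o by (meson dvd_trans int_dvd_int_iff)
    from psi_int_pow_eq[OF g this] have "\<psi> g = \<psi> (g [^]\<^bsub>F2\<^esub> ?q) [^] k"
      using g by (simp add: hom_int_pow H.int_pow_pow)
    then show ?thesis using H.subgroup_int_pow_closed[OF A.subgroup_axioms A] by simp
  qed
  have x: "\<psi> gx \<in> ?A"
    using pow[OF gens_in_F2(1) _ ord(1)] inA[OF gens_in_F2(1)] unfolding twist(2)[OF f] by blast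
  let ?Y = "\<psi> (gy [^]\<^bsub>F2\<^esub> ?q)"
  have cl: "?Y \<in> carrier H" "\<psi> r \<in> carrier H" "\<psi> v \<in> carrier H"
    using gens_in_F2(2) r v by simp_all
  have "\<psi> (?\<theta> gy) = inv (\<psi> v) \<otimes> (inv (\<psi> r) \<otimes> (?Y \<otimes> (\<psi> r \<otimes> \<psi> v)))"
    using cl by (simp add: psi_twist_y[OF f] psi_f H.inv_mult_group H.m_assoc)
  also have "inv (\<psi> r) \<otimes> (?Y \<otimes> (\<psi> r \<otimes> \<psi> v)) = \<psi> (inv\<^bsub>F2\<^esub> r \<otimes>\<^bsub>F2\<^esub> (gy [^]\<^bsub>F2\<^esub> ?q \<otimes>\<^bsub>F2\<^esub> r)) \<otimes> \<psi> v"
    using cl r gens_in_F2(2) by (simp add: H.m_assoc)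
  also have "\<dots> = \<psi> v \<otimes> \<psi> (inv\<^bsub>F2\<^esub> r \<otimes>\<^bsub>F2\<^esub> (gy [^]\<^bsub>F2\<^esub> ?q \<otimes>\<^bsub>F2\<^esub> r))"
    using r gens_in_F2(2) by (intro central[symmetric]) simp
  finally have "\<psi> (?\<theta> gy) = inv (\<psi> r) \<otimes> (?Y \<otimes> \<psi> r)"
    using cl r gens_in_F2(2) by (simp add: H.cancel_left)
  then have Y: "?Y = \<psi> r \<otimes> \<psi> (?\<theta> gy) \<otimes> inv (\<psi> r)"
    using cl by (simp add: H.m_assoc H.cancel_left)
  have "\<psi> r \<in> ?A" unfolding r_def by (rule inA[OF g(1)])
  then have "?Y \<in> ?A"
    unfolding Y by (intro A.m_closed A.m_inv_closed inA gens_in_F2)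
  then have y: "\<psi> gy \<in> ?A" by (rule pow[OF gens_in_F2(2) _ ord(2)])
  have "\<psi> ` carrier F2 = generate H (\<psi> ` {gx, gy})"
    using generate_img[of "{gx, gy}"] gens_in_F2 generate_F2 by simp
  also have "\<dots> \<subseteq> ?A"
    using x y by (intro H.generate_subgroup_incl A.subgroup_axioms) simp
  finally show "\<psi> ` carrier F2 \<subseteq> ?A" .
qed

end

section \<open>Child's drawings\<close>

declare sym_group_inv_equality [simp del]

lemma sym_group_inverse:
  assumes "s \<in> carrier (sym_group d)"
  shows "inv\<^bsub>sym_group d\<^esub> s \<circ> s = id" "s \<circ> inv\<^bsub>sym_group d\<^esub> s = id"
  using group.l_inv[OF sym_group_is_group assms] group.r_inv[OF sym_group_is_group assms]
  by (simp_all add: sym_group_mult sym_group_one)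

lemma sym_group_range: "s \<in> carrier (sym_group d) \<Longrightarrow> s i \<in> {1..d} \<longleftrightarrow> i \<in> {1..d}"
  by (simp add: sym_group_carrier permutes_in_image del: atLeastAtMost_iff)

abbreviation conj_hom :: "nat \<Rightarrow> (nat \<Rightarrow> nat) \<Rightarrow> (braid \<Rightarrow> nat \<Rightarrow> nat) \<Rightarrow> braid \<Rightarrow> nat \<Rightarrow> nat" where
  "conj_hom d s \<psi> \<equiv>
    \<lambda>g\<in>carrier F2. s \<otimes>\<^bsub>sym_group d\<^esub> \<psi> g \<otimes>\<^bsub>sym_group d\<^esub> inv\<^bsub>sym_group d\<^esub> s"

lemma conj_hom_in_hom:
  assumes "\<psi> \<in> hom F2 (sym_group d)" "s \<in> carrier (sym_group d)"
  shows "conj_hom d s \<psi> \<in> hom F2 (sym_group d)"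
proof -
  interpret group_hom F2 "sym_group d" \<psi>
    using assms by (simp add: group_hom_def group_hom_axioms_def group_F2 sym_group_is_group)
  show ?thesis
    using assms(2) by (auto simp: hom_def H.m_assoc H.cancel_left)
qed

lemma conj_hom_mult:
  assumes "\<psi> \<in> carrier F2 \<rightarrow> carrier (sym_group d)"
    and "s \<in> carrier (sym_group d)" "t \<in> carrier (sym_group d)"
  shows "conj_hom d s (conj_hom d t \<psi>) = conj_hom d (s \<otimes>\<^bsub>sym_group d\<^esub> t) \<psi>"
proof -
  interpret group "sym_group d" by (rule sym_group_is_group)
  show ?thesis
    using assms by (intro restrict_ext) (simp add: Pi_iff m_assoc inv_mult_group)
qed

lemma conj_hom_in_dessin_class: "s \<in> carrier (sym_group d) \<Longrightarrow> conj_hom d s \<psi> \<in> dessin_class d \<psi>"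
  unfolding dessin_class_def by blast

text \<open>By \<open>conj_hom_mult\<close> conjugation is a group action, and points of one orbit
  have the same orbit.\<close>

lemma dessin_class_conj_hom:
  assumes \<psi>: "\<psi> \<in> carrier F2 \<rightarrow> carrier (sym_group d)"
    and s: "s \<in> carrier (sym_group d)"
  shows "dessin_class d (conj_hom d s \<psi>) = dessin_class d \<psi>"
proof -
  interpret group "sym_group d" by (rule sym_group_is_group)
  show ?thesis
  proof (intro equalityI subsetI)
    fix \<chi> assume "\<chi> \<in> dessin_class d (conj_hom d s \<psi>)"
    then obtain t where t: "t \<in> carrier (sym_group d)" "\<chi> = conj_hom d t (conj_hom d s \<psi>)"
      unfolding dessin_class_def by blast
    have "\<chi> = conj_hom d (t \<otimes>\<^bsub>sym_group d\<^esub> s) \<psi>"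
      unfolding t(2) by (rule conj_hom_mult[OF \<psi> t(1) s])
    then show "\<chi> \<in> dessin_class d \<psi>"
      using conj_hom_in_dessin_class[OF m_closed[OF t(1) s]] by (simp only:)
  next
    fix \<chi> assume "\<chi> \<in> dessin_class d \<psi>"
    then obtain t where t: "t \<in> carrier (sym_group d)" "\<chi> = conj_hom d t \<psi>"
      unfolding dessin_class_def by blast
    let ?t = "t \<otimes>\<^bsub>sym_group d\<^esub> inv\<^bsub>sym_group d\<^esub> s"
    have c: "?t \<in> carrier (sym_group d)" and "?t \<otimes>\<^bsub>sym_group d\<^esub> s = t"
      using s t by (simp_all add: m_assoc)
    then have "\<chi> = conj_hom d ?t (conj_hom d s \<psi>)"
      using conj_hom_mult[OF \<psi> c s] t(2) by (simp only:)
    then show "\<chi> \<in> dessin_class d (conj_hom d s \<psi>)"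
      using conj_hom_in_dessin_class[OF c] by (simp only:)
  qed
qed

lemma self_in_dessin_class:
  assumes "dessin_hom d \<psi>"
  shows "\<psi> \<in> dessin_class d \<psi>"
proof -
  interpret group_hom F2 "sym_group d" \<psi>
    using assms by (simp add: dessin_hom_def group_hom_def group_hom_axioms_def group_F2 sym_group_is_group)
  have "conj_hom d \<one>\<^bsub>sym_group d\<^esub> \<psi> = \<psi>"
    using assms by (intro extensionalityI[of _ "carrier F2"]) (auto simp: dessin_hom_def)
  then show ?thesis using conj_hom_in_dessin_class[OF H.one_closed, of \<psi>] by (simp only:)
qed

lemma dessin_hom_conj_hom:
  assumes \<psi>: "dessin_hom d \<psi>" and s: "s \<in> carrier (sym_group d)"
  shows "dessin_hom d (conj_hom d s \<psi>)"
proof -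
  interpret group "sym_group d" by (rule sym_group_is_group)
  have "\<exists>g\<in>carrier F2. conj_hom d s \<psi> g i = j" if ij: "i \<in> {1..d}" "j \<in> {1..d}" for i j
  proof -
    let ?t = "inv\<^bsub>sym_group d\<^esub> s"
    have "?t i \<in> {1..d}" "?t j \<in> {1..d}" using ij s by (simp_all only: sym_group_range inv_closed)
    then obtain g where g: "g \<in> carrier F2" "\<psi> g (?t i) = ?t j"
      using \<psi> unfolding dessin_hom_def by blast
    moreover have "s (?t j) = j" using fun_cong[OF sym_group_inverse(2)[OF s], of j] by simp
    ultimately show ?thesis by (intro bexI[of _ g]) (simp_all add: sym_group_mult)
  qed
  then show ?thesis
    using \<psi> conj_hom_in_hom[OF _ s] unfolding dessin_hom_def by simp
qed

text \<open>By transitivity some value of \<psi> carries 1 to \<open>e\<close>, but as a permutation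
  of \<open>{1..d}\<close> it keeps 1 inside \<open>{1..d}\<close>. Applied both ways, this makes
  the degree of a child's drawing unique.\<close>

lemma dessin_hom_degree_le:
  assumes "dessin_hom d \<psi>" "dessin_hom e \<psi>"
  shows "e \<le> d"
proof -
  have "1 \<in> {1..e}" "e \<in> {1..e}" "1 \<in> {1..d}" using assms by (simp_all add: dessin_hom_def)
  then obtain g where g: "g \<in> carrier F2" "\<psi> g 1 = e"
    using assms(2) unfolding dessin_hom_def by blast
  then have "\<psi> g \<in> carrier (sym_group d)" using assms(1) by (auto simp: dessin_hom_def hom_def)
  then have "\<psi> g 1 \<in> {1..d}" using \<open>1 \<in> {1..d}\<close> by (simp only: sym_group_range)
  then show ?thesis using g by simp
qed

lemma dessin_degree_class:
  assumes "dessin_hom d \<psi>"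
  shows "dessin_degree (dessin_class d \<psi>) = d"
  unfolding dessin_degree_def
proof (rule the_equality)
  show "dessin_class d \<psi> \<in> child_drawings d" using assms by (auto simp: child_drawings_def)
  fix e assume "dessin_class d \<psi> \<in> child_drawings e"
  then obtain \<chi> where \<chi>: "dessin_hom e \<chi>" "dessin_class d \<psi> = dessin_class e \<chi>"
    by (auto simp: child_drawings_def)
  then have "\<psi> \<in> dessin_class e \<chi>" using self_in_dessin_class[OF assms] by simp
  then obtain s where "s \<in> carrier (sym_group e)" "\<psi> = conj_hom e s \<chi>"
    by (auto simp: dessin_class_def)
  then have "dessin_hom e \<psi>" using dessin_hom_conj_hom[OF \<chi>(1)] by simp
  then show "e = d" using assms dessin_hom_degree_le by (metis le_antisym)
qed

text \<open>The right side depends on \<psi> only through its image, so homomorphisms of the same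
  degree with equal images give the same monodromy group.\<close>

lemma monodromy_group_class:
  "monodromy_group (dessin_class d \<psi>) =
    {(\<lambda>p. s \<otimes>\<^bsub>sym_group d\<^esub> p \<otimes>\<^bsub>sym_group d\<^esub> inv\<^bsub>sym_group d\<^esub> s) ` (\<psi> ` carrier F2) | s.
      s \<in> carrier (sym_group d)}"
proof -
  have "monodromy_group (dessin_class d \<psi>) =
      {conj_hom d s \<psi> ` carrier F2 | s. s \<in> carrier (sym_group d)}"
    unfolding monodromy_group_def dessin_class_def by blast
  then show ?thesis by (simp add: image_image)
qed

lemma gt_class_eqD:
  assumes "gt_class N m f = gt_class N m' f'"
  shows "int (N_ord N) dvd m' - m" and "N_PB3 N #>\<^bsub>PB 3\<^esub> f = N_PB3 N #>\<^bsub>PB 3\<^esub> f'"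
proof -
  have "m' + int (N_ord N) * 0 \<in> {m' + int (N_ord N) * k | k. True}" by blast
  then have "m' \<in> {m + int (N_ord N) * k | k. True}" using assms by (simp add: gt_class_def)
  then show "int (N_ord N) dvd m' - m" by auto
  show "N_PB3 N #>\<^bsub>PB 3\<^esub> f = N_PB3 N #>\<^bsub>PB 3\<^esub> f'" using assms by (simp add: gt_class_def)
qed

theorem mainTheorem9:
  fixes N :: "braid set"
    and D :: "(braid \<Rightarrow> nat \<Rightarrow> nat) set"
    and s :: "int set \<times> braid set"
  assumes "N \<in> NFI_PB4"
    and "D \<in> Dessin N"
    and "s \<in> GT N"
  shows "dessin_act N D s \<in> child_drawings (dessin_degree (dessin_act N D s)) \<and>
    dessin_degree (dessin_act N D s) = dessin_degree D \<and>
    monodromy_group (dessin_act N D s) = monodromy_group D"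
proof -
  obtain d \<psi> where D: "D = dessin_class d \<psi>" and \<psi>: "dessin_hom d \<psi>"
    and ker: "N_F2 N \<subseteq> kernel F2 (sym_group d) \<psi>"
    using assms(2) by (auto simp: Dessin_def)
  obtain m f where s: "s = gt_class N m f" and f: "f \<in> carrier F2"
    and unit: "\<exists>k. [(2 * m + 1) * k = 1] (mod int (N_ord N))" and onto: "gt_hom_onto N m f"
    using assms(3) by (auto simp: GT_def)
  let ?K = "N_PB3 N"
  have \<psi>_hom: "\<psi> \<in> hom F2 (sym_group d)" using \<psi> by (simp add: dessin_hom_def)
  interpret subordinate_hom "sym_group d" \<psi> ?K
    using \<psi>_hom normal_N_PB3[OF assms(1)] ker
    by (simp add: subordinate_hom_def subordinate_hom_axioms_def group_hom_def group_hom_axioms_def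
        group_F2 sym_group_is_group N_F2_def)
  have ord: "group.ord (PB 3 Mod ?K) (coset gx) dvd N_ord N"
    "group.ord (PB 3 Mod ?K) (coset gy) dvd N_ord N"
    by (simp_all add: N_ord_def Let_def)
  obtain k where k: "[(2 * m + 1) * k = 1] (mod int (N_ord N))" using unit by blast
  obtain T where T: "T \<in> hom (PB 3) (PB 3 Mod ?K)" "T gx = coset (gx [^]\<^bsub>PB 3\<^esub> (2 * m + 1))"
    "T gy = coset (group_prod (PB 3) [inv\<^bsub>PB 3\<^esub> f, gy [^]\<^bsub>PB 3\<^esub> (2 * m + 1), f])"
    "T c3 = coset (c3 [^]\<^bsub>PB 3\<^esub> (2 * m + 1))" "T ` carrier (PB 3) = carrier (PB 3 Mod ?K)"
    using onto by (auto simp: gt_hom_onto_def Let_def)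
  define h where "h = (\<lambda>g\<in>carrier F2. \<psi> (twist m f g))"
  have image: "h ` carrier F2 = \<psi> ` carrier F2"
    using twisted_image[OF f ord k T] by (simp add: h_def)
  interpret th: group_hom F2 "sym_group d" "\<psi> \<circ> twist m f" by (rule twist_hom[OF f])
  have h: "dessin_hom d h"
    unfolding dessin_hom_def
  proof (intro conjI ballI)
    show "1 \<le> d" using \<psi> by (simp add: dessin_hom_def)
    show "h \<in> hom F2 (sym_group d)" using th.homh by (simp add: h_def hom_def Pi_iff)
    show "h \<in> extensional (carrier F2)" by (simp add: h_def)
    fix i j assume "i \<in> {1..d}" "j \<in> {1..d}"
    then obtain g where g: "g \<in> carrier F2" "\<psi> g i = j" using \<psi> unfolding dessin_hom_def by blast
    \<comment> \<open>\<psi> and \<open>h\<close> take the same set of values, so the permutation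
      sending \<open>i\<close> to \<open>j\<close> is also a value of \<open>h\<close>, possibly at
      another element of \<open>F2\<close>.\<close>
    then have "\<psi> g \<in> h ` carrier F2" unfolding image by blast
    then show "\<exists>g\<in>carrier F2. h g i = j" using g(2) by auto
  qed
  have deg: "dessin_degree D = d" unfolding D by (rule dessin_degree_class[OF \<psi>])
  have act: "dessin_act N D s = dessin_class d h"
    unfolding dessin_act_def deg
  proof (rule the_equality)
    have "twisted_hom d \<psi> m f = h" unfolding h_def by (rule twisted_hom_eq[OF f \<psi>_hom])
    then show "\<exists>\<psi> m f. \<psi> \<in> D \<and> f \<in> carrier F2 \<and> gt_class N m f = s \<and>
        dessin_class d h = dessin_class d (twisted_hom d \<psi> m f)"
      using self_in_dessin_class[OF \<psi>] f s unfolding D by metis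
  next
    fix E assume "\<exists>\<psi> m f. \<psi> \<in> D \<and> f \<in> carrier F2 \<and> gt_class N m f = s \<and>
        E = dessin_class d (twisted_hom d \<psi> m f)"
    then obtain \<psi>' m' f' where *: "\<psi>' \<in> D" "f' \<in> carrier F2" "gt_class N m' f' = s"
      "E = dessin_class d (twisted_hom d \<psi>' m' f')" by blast
    obtain t where t: "t \<in> carrier (sym_group d)" "\<psi>' = conj_hom d t \<psi>"
      using *(1) unfolding D dessin_class_def by blast
    have "gt_class N m f = gt_class N m' f'" using s *(3) by simp
    note gt = gt_class_eqD[OF this]
    have o: "int (group.ord (PB 3 Mod ?K) (coset gx)) dvd m' - m"
      "int (group.ord (PB 3 Mod ?K) (coset gy)) dvd m' - m"
      using ord gt(1) by (meson dvd_trans int_dvd_int_iff)+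
    interpret th': group_hom F2 F2 "twist m' f'"
      using twist(1)[OF *(2)] by (simp add: group_hom_def group_hom_axioms_def group_F2)
    have "twisted_hom d \<psi>' m' f' = (\<lambda>g\<in>carrier F2. \<psi>' (twist m' f' g))"
      unfolding t(2) by (rule twisted_hom_eq[OF *(2) conj_hom_in_hom[OF \<psi>_hom t(1)]])
    \<comment> \<open>Conjugation acts on values and twisting on arguments, so the two commute; the
      change from \<open>(m', f')\<close> to \<open>(m, f)\<close> is absorbed by
      \<open>psi_twist_cong\<close>.\<close>
    also have "\<dots> = conj_hom d t h"
      unfolding t(2) using psi_twist_cong[OF f *(2) gt(2) o]
      by (intro restrict_ext) (simp add: h_def)
    finally show "E = dessin_class d h"
      unfolding *(4) using t(1) h
      by (simp only:) (rule dessin_class_conj_hom; auto simp: dessin_hom_def hom_def)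
  qed
  have "dessin_class d h \<in> child_drawings d" using h by (auto simp: child_drawings_def)
  moreover have "monodromy_group (dessin_class d h) = monodromy_group D"
    unfolding D monodromy_group_class image ..
  ultimately show ?thesis
    unfolding act deg dessin_degree_class[OF h] by simp
qed

end
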